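(* If the $G$-action on $R$ is Galois, then $R^G$ is Cohen-Macaulay if and only if $R$ is Cohen-Macaulay.
   Context: $G$ is a finite group and $R$ is a commutative ring on which $G$ acts by ring automorphisms; $R^G$ is the subring of $G$-invariants. The inertia group of an ideal $\mathfrak{Q}$ of $R$ is $I_G(\mathfrak{Q})=\{g\in G\mid (g-1)(R)\subset\mathfrak{Q}\}$. The $G$-action on $R$ is called Galois (in the sense of Auslander and Goldman) if every maximal ideal of $R$ has trivial inertia group in $G$. Cohen-Macaulay rings are in particular noetherian. *)

theory Defs
  imports "HOL-Algebra.Algebra" "HOL-Library.Extended_Nat"
begin

text \<open>
  The bijections in \<^const>\<open>BijGroup\<close> are extensional, so \<open>\<phi> g\<close> is \<^const>\<open>undefined\<close> off the
  carrier of \<open>R\<close>; this only fixes junk values.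
\<close>

locale ring_action = cring R + group_action G "carrier R" \<phi>
  for G :: "('g, 'm) monoid_scheme" and R :: "('r, 'n) ring_scheme" (structure)
    and \<phi> :: "'g \<Rightarrow> 'r \<Rightarrow> 'r" +
  assumes ring_automorphism: "g \<in> carrier G \<Longrightarrow> \<phi> g \<in> ring_iso R R"

definition invariant_ring ::
    "('g, 'm) monoid_scheme \<Rightarrow> ('r, 'n) ring_scheme \<Rightarrow> ('g \<Rightarrow> 'r \<Rightarrow> 'r) \<Rightarrow> ('r, 'n) ring_scheme"
  where "invariant_ring G R \<phi> =
    R\<lparr>carrier := {r \<in> carrier R. \<forall>g \<in> carrier G. \<phi> g r = r}\<rparr>"

definition inertia_group ::
    "('g, 'm) monoid_scheme \<Rightarrow> ('r, 'n) ring_scheme \<Rightarrow> ('g \<Rightarrow> 'r \<Rightarrow> 'r) \<Rightarrow> 'r set \<Rightarrow> 'g set"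
  where "inertia_group G R \<phi> Q =
    {g \<in> carrier G. \<forall>r \<in> carrier R. \<phi> g r \<ominus>\<^bsub>R\<^esub> r \<in> Q}"

definition galois_action ::
    "('g, 'm) monoid_scheme \<Rightarrow> ('r, 'n) ring_scheme \<Rightarrow> ('g \<Rightarrow> 'r \<Rightarrow> 'r) \<Rightarrow> bool"
  where "galois_action G R \<phi> \<longleftrightarrow>
    (\<forall>M. maximalideal M R \<longrightarrow> inertia_group G R \<phi> M = {\<one>\<^bsub>G\<^esub>})"

text \<open>
  The height of a prime ideal \<open>P\<close>: the supremum of the lengths \<open>n\<close> of strict chains of primes
  \<open>Q 0 \<subset> \<dots> \<subset> Q n = P\<close>.
\<close>

definition prime_height :: "('a, 'b) ring_scheme \<Rightarrow> 'a set \<Rightarrow> enat"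
  where "prime_height R P =
    (SUP n \<in> {n. \<exists>Q :: nat \<Rightarrow> 'a set. (\<forall>i \<le> n. primeideal (Q i) R) \<and>
                 (\<forall>i < n. Q i \<subset> Q (Suc i)) \<and> Q n = P}. enat n)"

text \<open>
  A sequence is regular if each \<open>x\<^sub>i\<close> is a nonzerodivisor on \<open>R / (x\<^sub>0, \<dots>, x\<^sub>i\<^sub>-\<^sub>1)\<close> (spelled out
  on representatives) and the whole sequence generates a proper ideal.
\<close>

definition regular_sequence :: "('a, 'b) ring_scheme \<Rightarrow> 'a list \<Rightarrow> bool"
  where "regular_sequence R xs \<longleftrightarrow>
    set xs \<subseteq> carrier R \<and>
    (\<forall>i < length xs. \<forall>r \<in> carrier R.
       xs ! i \<otimes>\<^bsub>R\<^esub> r \<in> Idl\<^bsub>R\<^esub> (set (take i xs)) \<longrightarrow> r \<in> Idl\<^bsub>R\<^esub> (set (take i xs))) \<and>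
    Idl\<^bsub>R\<^esub> (set xs) \<noteq> carrier R"

text \<open>
  The depth (grade) of an ideal on \<open>R\<close>. Over a noetherian ring all maximal regular sequences in a
  proper ideal have the same length; the supremum avoids building this fact into the definition.
\<close>

definition ideal_depth :: "('a, 'b) ring_scheme \<Rightarrow> 'a set \<Rightarrow> enat"
  where "ideal_depth R I =
    (SUP xs \<in> {xs. regular_sequence R xs \<and> set xs \<subseteq> I}. enat (length xs))"

text \<open>
  Cohen-Macaulay rings as in Kaplansky (\<open>Commutative Rings\<close>, Section 3-1) and Eisenbud
  (\<open>Commutative Algebra\<close>, Section 18.2): depth equals height at every maximal ideal. No
  finiteness of the Krull dimension is imposed, and the zero ring qualifies.
\<close>

definition cohen_macaulay :: "('a, 'b) ring_scheme \<Rightarrow> bool"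
  where "cohen_macaulay R \<longleftrightarrow>
    cring R \<and> noetherian_ring R \<and>
    (\<forall>M. maximalideal M R \<longrightarrow> ideal_depth R M = prime_height R M)"

end

theory Submission
  imports Defs
begin

text \<open>
  Put \<open>A = R\<^sup>G\<close>. The Galois condition yields \<open>x\<^sub>i, y\<^sub>i\<close> in \<open>R\<close> with
  \<open>\<Sum> x\<^sub>i g(y\<^sub>i) = \<delta>\<^sub>g\<^sub>,\<^sub>1\<close>, hence \<open>r = \<Sum> x\<^sub>i tr(y\<^sub>i r)\<close> for all \<open>r\<close>, and by Nakayama the
  trace is onto \<open>A\<close>. For an ideal \<open>I\<close> of \<open>A\<close> this gives \<open>r \<in> IR\<close> iff \<open>tr(s r) \<in> I\<close> for all \<open>s\<close>, so that
  \<open>IR \<inter> A = I\<close> and \<open>R\<close> is flat over \<open>A\<close>; noetherianity passes both ways. Since \<open>N(r) = \<Prod> g(r)\<close> lies in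
  \<open>A\<close>, prime avoidance shows that \<open>G\<close> permutes the primes over a given one transitively, and heights
  are preserved under contraction. A regular sequence of \<open>A\<close> is regular on \<open>R\<close> by
  flatness. Conversely, if \<open>x\<^sub>1, \<dots>, x\<^sub>k\<close> in \<open>M \<inter> A\<close> is a regular sequence shorter than some
  regular sequence in a maximal ideal \<open>M\<close> of \<open>R\<close>, then by Rees' theorem some \<open>z \<in> M\<close> extends it on \<open>R\<close>, and then so does \<open>N(z) \<in> M \<inter> A\<close>, because the ideal generated by the
  \<open>x\<^sub>i\<close> is \<open>G\<close>-stable. Thus depth and height at \<open>M\<close> and at \<open>M \<inter> A\<close> agree.
\<close>

section \<open>Ideals, primes and noetherian rings\<close>

lemma (in cring) ideal_if_closed:
  assumes "I \<subseteq> carrier R" "\<zero> \<in> I"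
    and "\<And>a b. a \<in> I \<Longrightarrow> b \<in> I \<Longrightarrow> a \<oplus> b \<in> I"
    and "\<And>a r. a \<in> I \<Longrightarrow> r \<in> carrier R \<Longrightarrow> r \<otimes> a \<in> I"
  shows "ideal I R"
proof (rule idealI[OF ring_axioms])
  show "subgroup I (add_monoid R)"
  proof (rule add.subgroupI)
    fix a assume a: "a \<in> I"
    then have "\<ominus> a = (\<ominus> \<one>) \<otimes> a" using assms(1) by (simp add: l_minus subsetD)
    then show "\<ominus> a \<in> I" using assms(4)[OF a, of "\<ominus> \<one>"] by simp
  qed (use assms in auto)
next
  fix a x assume "a \<in> I" "x \<in> carrier R"
  then show "x \<otimes> a \<in> I" "a \<otimes> x \<in> I"
    using assms(1,4) m_comm[of a x] by auto
qed

lemma (in ideal) add_mem: "a \<in> I \<Longrightarrow> b \<in> I \<Longrightarrow> a \<oplus> b \<in> I"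
  using additive_subgroup.a_closed[OF additive_subgroup_axioms] .

lemma (in ideal) a_minus_closed: "a \<in> I \<Longrightarrow> b \<in> I \<Longrightarrow> a \<ominus> b \<in> I"
  unfolding a_minus_def using add_mem a_inv_closed by blast

lemma (in ideal) mem_if_diff_mem:
  assumes "a \<ominus> b \<in> I" "b \<in> I" "a \<in> carrier R"
  shows "a \<in> I"
proof -
  have "a = (a \<ominus> b) \<oplus> b"
    using assms Icarr by (simp add: minus_eq a_assoc l_neg)
  then show ?thesis using assms add_mem by metis
qed

lemma (in primeideal) finprod_mem:
  "finite T \<Longrightarrow> f \<in> T \<rightarrow> carrier R \<Longrightarrow> finprod R f T \<in> I \<Longrightarrow> \<exists>x\<in>T. f x \<in> I"
proof (induct T rule: finite_induct)
  case empty
  then show ?case using one_imp_carrier I_notcarr by auto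
next
  case (insert x F)
  then have "f x \<otimes> finprod R f F \<in> I" by auto
  then have "f x \<in> I \<or> finprod R f F \<in> I"
    using insert by (intro I_prime) auto
  with insert show ?case by auto
qed

text \<open>Adjoining one generator at a time keeps elements in an explicit two-term form. All later
  computations modulo initial segments of sequences rest on it.\<close>

lemma (in cring) Idl_insert:
  assumes "B \<subseteq> carrier R" "x \<in> carrier R"
  shows "Idl (insert x B) = {i \<oplus> x \<otimes> r | i r. i \<in> Idl B \<and> r \<in> carrier R}" (is "_ = ?J")
proof -
  interpret B: ideal "Idl B" R using genideal_ideal[OF assms(1)] .
  interpret xB: ideal "Idl (insert x B)" R using genideal_ideal assms by simp
  have "ideal ?J R"
  proof (rule ideal_if_closed)
    show "?J \<subseteq> carrier R" using assms B.Icarr by auto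
    show "\<zero> \<in> ?J"
      by (rule CollectI, rule exI[of _ \<zero>], rule exI[of _ \<zero>]) (use assms in simp)
  next
    fix a b assume "a \<in> ?J" "b \<in> ?J"
    then obtain i r j s where *: "i \<in> Idl B" "r \<in> carrier R" "j \<in> Idl B" "s \<in> carrier R"
      "a = i \<oplus> x \<otimes> r" "b = j \<oplus> x \<otimes> s" by auto
    then have "a \<oplus> b = (i \<oplus> j) \<oplus> x \<otimes> (r \<oplus> s)"
      using assms B.Icarr by algebra
    then show "a \<oplus> b \<in> ?J" using * by blast
  next
    fix a t assume "a \<in> ?J" and t: "t \<in> carrier R"
    then obtain i r where *: "i \<in> Idl B" "r \<in> carrier R" "a = i \<oplus> x \<otimes> r" by auto
    then have "t \<otimes> a = t \<otimes> i \<oplus> x \<otimes> (t \<otimes> r)"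
      using assms B.Icarr t by algebra
    then show "t \<otimes> a \<in> ?J" using * t B.I_l_closed by blast
  qed
  moreover have "insert x B \<subseteq> ?J"
  proof (rule insert_subsetI)
    show "x \<in> ?J"
      by (rule CollectI, rule exI[of _ \<zero>], rule exI[of _ \<one>]) (use assms in simp)
    show "B \<subseteq> ?J"
    proof
      fix b assume "b \<in> B"
      then show "b \<in> ?J"
        by (intro CollectI exI[of _ b] exI[of _ \<zero>])
          (use assms genideal_self[OF assms(1)] in auto)
    qed
  qed
  ultimately have "Idl (insert x B) \<subseteq> ?J" by (rule genideal_minimal)
  moreover have "?J \<subseteq> Idl (insert x B)"
  proof -
    have "Idl B \<subseteq> Idl (insert x B)" using assms by (intro subset_Idl_subset) auto
    moreover have "x \<in> Idl (insert x B)" using assms genideal_self[of "insert x B"] by auto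
    ultimately show ?thesis using xB.I_r_closed by auto
  qed
  ultimately show ?thesis by blast
qed

lemma (in cring) colon_ideal:
  assumes "ideal I R" "a \<in> carrier R"
  shows "ideal {r \<in> carrier R. r \<otimes> a \<in> I} R"
proof -
  interpret ideal I R by fact
  show ?thesis
    by (rule ideal_if_closed) (use assms(2) in \<open>auto simp: l_distr m_assoc I_l_closed\<close>)
qed

section \<open>Maximal and prime ideals from Zorn's lemma\<close>

lemma (in ring) exists_ideal_maximal_disjoint:
  assumes "ideal I R" "I \<inter> S = {}"
  obtains M where "ideal M R" "I \<subseteq> M" "M \<inter> S = {}"
    "\<And>J. ideal J R \<Longrightarrow> M \<subset> J \<Longrightarrow> J \<inter> S \<noteq> {}"
proof -
  define T where "T = {J. ideal J R \<and> I \<subseteq> J \<and> J \<inter> S = {}}"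
  have "\<exists>M\<in>T. \<forall>J\<in>T. M \<subseteq> J \<longrightarrow> J = M"
  proof (rule subset_Zorn)
    fix C assume C: "subset.chain T C"
    show "\<exists>U\<in>T. \<forall>J\<in>C. J \<subseteq> U"
    proof (cases "C = {}")
      case True
      then show ?thesis using assms by (auto simp: T_def)
    next
      case False
      have "subset.chain {J. ideal J R} C"
        using C by (auto simp: T_def pred_on.chain_def)
      then have "ideal (\<Union>C) R" using chain_Union_is_ideal[of C] False by (simp only: if_False)
      moreover have "C \<subseteq> T" using C by (auto simp: pred_on.chain_def)
      ultimately have "\<Union>C \<in> T" using False by (auto simp: T_def)
      then show ?thesis by blast
    qed
  qed
  then obtain M where M: "M \<in> T" "\<And>J. J \<in> T \<Longrightarrow> M \<subseteq> J \<Longrightarrow> J = M" by blast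
  show thesis
    by (rule that[of M]) (use M in \<open>auto simp: T_def\<close>)
qed

lemma (in ring) exists_maximalideal:
  assumes "ideal I R" "I \<noteq> carrier R"
  obtains M where "maximalideal M R" "I \<subseteq> M"
proof -
  \<comment> \<open>Being proper means missing one, so maximal ideals are the case
    \<open>S = {\<one>}\<close> of the preceding lemma.\<close>
  have proper: "J \<inter> {\<one>} = {} \<longleftrightarrow> J \<noteq> carrier R" if "ideal J R" for J
    using ideal.one_imp_carrier[OF that] by auto
  obtain M where M: "ideal M R" "I \<subseteq> M" "M \<inter> {\<one>} = {}"
    "\<And>J. ideal J R \<Longrightarrow> M \<subset> J \<Longrightarrow> J \<inter> {\<one>} \<noteq> {}"
    using exists_ideal_maximal_disjoint[of I "{\<one>}"] assms proper by metis
  have "maximalideal M R"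
    using M proper by (intro maximalidealI) blast+
  with M show thesis using that by blast
qed

text \<open>An ideal \<open>P\<close> maximal among those missing a multiplicative set is prime: for
  \<open>a\<close>, \<open>b\<close> outside \<open>P\<close> both \<open>(P, a)\<close> and
  \<open>(P, b)\<close> meet \<open>S\<close>, and the product of the two elements found lies in
  \<open>S\<close>, but also in \<open>P\<close> if \<open>a b\<close> does.\<close>

lemma (in cring) exists_primeideal_disjoint:
  assumes I: "ideal I R" "I \<inter> S = {}" and S: "S \<subseteq> carrier R" "\<one> \<in> S"
    "\<And>s t. s \<in> S \<Longrightarrow> t \<in> S \<Longrightarrow> s \<otimes> t \<in> S"
  obtains P where "primeideal P R" "I \<subseteq> P" "P \<inter> S = {}"
proof -
  obtain P where P: "ideal P R" "I \<subseteq> P" "P \<inter> S = {}"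
    "\<And>J. ideal J R \<Longrightarrow> P \<subset> J \<Longrightarrow> J \<inter> S \<noteq> {}"
    using exists_ideal_maximal_disjoint[OF I] by metis
  interpret P: ideal P R by fact
  have Psub: "P \<subseteq> carrier R" using P.Icarr by blast
  have IdlP: "Idl P = P" using P(1) Psub genideal_self genideal_minimal by blast
  have meets: "\<exists>i\<in>P. \<exists>r\<in>carrier R. i \<oplus> a \<otimes> r \<in> S" if "a \<in> carrier R" "a \<notin> P" for a
  proof -
    have "ideal (Idl (insert a P)) R" "P \<subset> Idl (insert a P)"
      using that Psub genideal_self[of "insert a P"] by (auto intro!: genideal_ideal)
    then have "Idl (insert a P) \<inter> S \<noteq> {}" using P(4) by blast
    then show ?thesis unfolding Idl_insert[OF Psub that(1)] IdlP by blast
  qed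
  have "primeideal P R"
  proof (rule primeidealI[OF P(1) is_cring])
    show "carrier R \<noteq> P" using P(3) S by auto
    fix a b assume ab: "a \<in> carrier R" "b \<in> carrier R" "a \<otimes> b \<in> P"
    show "a \<in> P \<or> b \<in> P"
    proof (rule ccontr)
      assume "\<not> ?thesis"
      then obtain i r j s where *: "i \<in> P" "r \<in> carrier R" "i \<oplus> a \<otimes> r \<in> S"
        "j \<in> P" "s \<in> carrier R" "j \<oplus> b \<otimes> s \<in> S"
        using meets ab by meson
      have "(i \<oplus> a \<otimes> r) \<otimes> (j \<oplus> b \<otimes> s)
          = (i \<otimes> (j \<oplus> b \<otimes> s) \<oplus> (a \<otimes> r) \<otimes> j) \<oplus> (a \<otimes> b) \<otimes> (r \<otimes> s)"
        using * ab P.Icarr by algebra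
      moreover have "\<dots> \<in> P"
        using * ab by (intro P.add_mem P.I_r_closed[of "a \<otimes> b"] P.I_r_closed[of i]
          P.I_l_closed[of j]) auto
      ultimately show False using S(3)[OF *(3,6)] P(3) by auto
    qed
  qed
  with P show thesis using that by blast
qed

lemma (in cring) prime_avoidance:
  assumes I: "ideal I R" and "finite F" "\<And>P. P \<in> F \<Longrightarrow> primeideal P R" "I \<subseteq> \<Union>F"
  shows "\<exists>P\<in>F. I \<subseteq> P"
  using assms(2-4)
proof (induct "card F" arbitrary: F)
  case 0
  then show ?case
    using additive_subgroup.zero_closed[OF ideal.axioms(1)[OF I]] by auto
next
  case (Suc n)
  interpret I: ideal I R by fact
  show ?case
  proof (cases "\<exists>P\<in>F. I \<subseteq> \<Union>(F - {P})")
    case True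
    then obtain P where "P \<in> F" "I \<subseteq> \<Union>(F - {P})" by blast
    moreover from this have "n = card (F - {P})" using Suc.hyps(2) by simp
    ultimately show ?thesis using Suc.hyps(1)[of "F - {P}"] Suc.prems(1,2) by blast
  next
    case False
    have "\<exists>a. a \<in> I \<and> a \<in> P \<and> (\<forall>Q\<in>F. a \<in> Q \<longrightarrow> Q = P)" if "P \<in> F" for P
    proof -
      have "\<not> I \<subseteq> \<Union>(F - {P})" using False that by simp
      then obtain a where a: "a \<in> I" "a \<notin> \<Union>(F - {P})" unfolding subset_iff by meson
      then have "a \<in> \<Union>F" using Suc.prems(3) by (meson subsetD)
      with a show ?thesis by blast
    qed
    then obtain a where a: "\<And>P. P \<in> F \<Longrightarrow> a P \<in> I"
      "\<And>P. P \<in> F \<Longrightarrow> a P \<in> P" "\<And>P Q. P \<in> F \<Longrightarrow> Q \<in> F \<Longrightarrow> a P \<in> Q \<Longrightarrow> Q = P"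
      by metis
    have carr: "a P \<in> carrier R" if "P \<in> F" for P using a(1)[OF that] I.Icarr by blast
    obtain P where P: "P \<in> F" using Suc by fastforce
    interpret P: primeideal P R using Suc P by blast
    show ?thesis
    proof (cases "F = {P}")
      case True
      then show ?thesis using Suc by auto
    next
      case ne: False
      \<comment> \<open>A second prime is needed for \<open>b\<close> to lie in \<open>I\<close>: an
        empty product would be one.\<close>
      then obtain Q0 where Q0: "Q0 \<in> F" "Q0 \<noteq> P" using P by auto
      define b where "b = finprod R a (F - {P})"
      have fin: "finite (F - {P})" using Suc by simp
      have Pi: "a \<in> F - {P} \<rightarrow> carrier R" using carr by auto
      have b: "b \<in> carrier R" using Pi b_def by simp
      have bQ: "b \<in> J" if "ideal J R" "Q \<in> F - {P}" "a Q \<in> J" for Q J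
      proof -
        have "b = a Q \<otimes> finprod R a (F - {P} - {Q})"
          unfolding b_def using fin that Pi
          by (subst finprod_insert[symmetric]) (auto simp: insert_absorb)
        moreover have "finprod R a (F - {P} - {Q}) \<in> carrier R" using Pi by (intro finprod_closed) auto
        ultimately show ?thesis using ideal.I_r_closed[OF that(1) that(3)] by simp
      qed
      have bI: "b \<in> I" using bQ[OF I, of Q0] Q0 a by auto
      have bP: "b \<notin> P"
        using P.finprod_mem[OF fin Pi] a(3)[of _ P] P unfolding b_def by auto
      have "a P \<oplus> b \<in> I" using a P bI by simp
      then obtain Q where Q: "Q \<in> F" "a P \<oplus> b \<in> Q" using Suc by blast
      interpret Q: primeideal Q R using Suc Q by blast
      have e: "a P = (a P \<oplus> b) \<ominus> b" "b = (a P \<oplus> b) \<ominus> a P"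
        using carr[OF P] b by algebra+
      show ?thesis
      proof (cases "Q = P")
        case True
        then have "b \<in> P" using e(2) Q(2) a(2)[OF P] P.a_minus_closed by metis
        with bP show ?thesis by simp
      next
        case False
        then have "b \<in> Q" using bQ[OF Q.is_ideal, of Q] Q a by auto
        then have "a P \<in> Q" using e(1) Q(2) Q.a_minus_closed by metis
        then show ?thesis using a(3) P Q False by auto
      qed
    qed
  qed
qed

section \<open>Maximal condition and finite generation\<close>

lemma (in noetherian_ring) exists_maximal_in_family:
  assumes "T \<noteq> {}" "\<And>I. I \<in> T \<Longrightarrow> ideal I R"
  shows "\<exists>M\<in>T. \<forall>J\<in>T. M \<subseteq> J \<longrightarrow> J = M"
proof (rule subset_Zorn)
  fix C assume C: "subset.chain T C"
  show "\<exists>U\<in>T. \<forall>J\<in>C. J \<subseteq> U"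
  proof (cases "C = {}")
    case False
    have "subset.chain {J. ideal J R} C"
      using C assms(2) by (auto simp: pred_on.chain_def)
    then have "\<Union>C \<in> C" using ideal_chain_is_trivial False by auto
    moreover have "C \<subseteq> T" using C by (auto simp: pred_on.chain_def)
    ultimately show ?thesis by blast
  qed (use assms in auto)
qed

text \<open>The point is that the generators come from \<open>T\<close> itself. Among the ideals
  generated by finite subsets of \<open>T\<close> a maximal one exists, and adjoining another
  element of \<open>T\<close> cannot enlarge it.\<close>

lemma (in noetherian_ring) Idl_finite_subset:
  assumes "T \<subseteq> carrier R"
  obtains F where "finite F" "F \<subseteq> T" "Idl F = Idl T"
proof -
  define Y where "Y = {Idl F | F. finite F \<and> F \<subseteq> T}"
  have "Y \<noteq> {}" by (auto simp: Y_def)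
  moreover have "\<And>I. I \<in> Y \<Longrightarrow> ideal I R" using assms by (auto simp: Y_def intro: genideal_ideal)
  ultimately obtain M where M: "M \<in> Y" "\<And>J. J \<in> Y \<Longrightarrow> M \<subseteq> J \<Longrightarrow> J = M"
    using exists_maximal_in_family by metis
  then obtain F where F: "finite F" "F \<subseteq> T" "M = Idl F" by (auto simp: Y_def)
  have "x \<in> Idl F" if "x \<in> T" for x
  proof -
    have sub: "insert x F \<subseteq> carrier R" using F that assms by auto
    have "Idl (insert x F) \<in> Y" using F that by (auto simp: Y_def)
    moreover have "M \<subseteq> Idl (insert x F)" 
      unfolding F(3) using sub by (intro subset_Idl_subset) auto
    ultimately have "Idl (insert x F) = M" by (rule M(2))
    then show ?thesis using F genideal_self[OF sub] by auto
  qed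
  then have "Idl T \<subseteq> Idl F"
    using F assms genideal_ideal by (intro genideal_minimal) auto
  moreover have "Idl F \<subseteq> Idl T" using F assms by (intro subset_Idl_subset)
  ultimately show thesis using that F by blast
qed

section \<open>Zerodivisors and regular sequences\<close>

definition nonzerodivisor_mod :: "('a, 'b) ring_scheme \<Rightarrow> 'a set \<Rightarrow> 'a \<Rightarrow> bool"
  where "nonzerodivisor_mod R I x \<longleftrightarrow> (\<forall>r\<in>carrier R. x \<otimes>\<^bsub>R\<^esub> r \<in> I \<longrightarrow> r \<in> I)"

lemma nonzerodivisor_modD:
  "nonzerodivisor_mod R I x \<Longrightarrow> r \<in> carrier R \<Longrightarrow> x \<otimes>\<^bsub>R\<^esub> r \<in> I \<Longrightarrow> r \<in> I"
  unfolding nonzerodivisor_mod_def by blast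

text \<open>The base set \<open>B\<close> holds the generators already adjoined, so that inductions
  can peel a sequence from the front and move its entries into \<open>B\<close>. Properness of the
  generated ideal is kept separate.\<close>

fun regular_over :: "('a, 'b) ring_scheme \<Rightarrow> 'a set \<Rightarrow> 'a list \<Rightarrow> bool"
  where
    "regular_over R B [] = True"
  | "regular_over R B (x # xs) =
      (nonzerodivisor_mod R (Idl\<^bsub>R\<^esub> B) x \<and> regular_over R (insert x B) xs)"

lemma regular_over_append:
  "regular_over R B (xs @ ys) \<longleftrightarrow> regular_over R B xs \<and> regular_over R (set xs \<union> B) ys"
  by (induct xs arbitrary: B) auto

lemma regular_over_iff_nth:
  "regular_over R B xs \<longleftrightarrow>
    (\<forall>i<length xs. nonzerodivisor_mod R (Idl\<^bsub>R\<^esub> (set (take i xs) \<union> B)) (xs ! i))"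
proof (induct xs arbitrary: B)
  case (Cons x xs)
  show ?case
    unfolding regular_over.simps(2) Cons
    by (simp add: All_less_Suc2)
qed simp

lemma regular_sequence_iff_regular_over:
  "regular_sequence R xs \<longleftrightarrow>
    set xs \<subseteq> carrier R \<and> regular_over R {} xs \<and> Idl\<^bsub>R\<^esub> (set xs) \<noteq> carrier R"
  unfolding regular_sequence_def regular_over_iff_nth nonzerodivisor_mod_def by simp

context cring
begin

lemma nonzerodivisor_mod_finprod:
  assumes "finite T" "f \<in> T \<rightarrow> carrier R" "\<And>t. t \<in> T \<Longrightarrow> nonzerodivisor_mod R I (f t)"
  shows "nonzerodivisor_mod R I (finprod R f T)"
  using assms
proof (induct T rule: finite_induct)
  case (insert t T)
  then have *: "f t \<in> carrier R" "finprod R f T \<in> carrier R" by auto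
  show ?case
    unfolding nonzerodivisor_mod_def
  proof (intro ballI impI)
    fix r assume r: "r \<in> carrier R" "finprod R f (insert t T) \<otimes> r \<in> I"
    have "finprod R f (insert t T) \<otimes> r = f t \<otimes> (finprod R f T \<otimes> r)"
      using insert * r by (simp add: m_assoc)
    then have "finprod R f T \<otimes> r \<in> I"
      using nonzerodivisor_modD[of R I "f t" "finprod R f T \<otimes> r"] r insert * by auto
    then show "r \<in> I"
      using nonzerodivisor_modD[of R I "finprod R f T" r] r insert by auto
  qed
qed (simp add: nonzerodivisor_mod_def)

text \<open>If \<open>x r = i + z s\<close>, then \<open>z s\<close> lies in \<open>(B, x)\<close>,
  so \<open>s = j + x t\<close>. Hence \<open>x (r - z t)\<close> lies in \<open>(B)\<close>, and
  cancelling \<open>x\<close> puts \<open>r\<close> in \<open>(B, z)\<close>.\<close>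

lemma nonzerodivisor_mod_swap:
  assumes B: "B \<subseteq> carrier R" and xz: "x \<in> carrier R" "z \<in> carrier R"
    and x: "nonzerodivisor_mod R (Idl B) x"
    and z: "nonzerodivisor_mod R (Idl (insert x B)) z"
  shows "nonzerodivisor_mod R (Idl (insert z B)) x"
  unfolding nonzerodivisor_mod_def
proof (intro ballI impI)
  interpret B: ideal "Idl B" R using genideal_ideal[OF B] .
  fix r assume r: "r \<in> carrier R" "x \<otimes> r \<in> Idl (insert z B)"
  then obtain i s where s: "i \<in> Idl B" "s \<in> carrier R" "x \<otimes> r = i \<oplus> z \<otimes> s"
    unfolding Idl_insert[OF B xz(2)] by blast
  have i: "i \<in> carrier R" using s B.Icarr by blast
  have "z \<otimes> s = \<ominus> i \<oplus> x \<otimes> r"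
    unfolding s(3) using i s xz by algebra
  then have "z \<otimes> s \<in> Idl (insert x B)"
    unfolding Idl_insert[OF B xz(1)] using s B.a_inv_closed r by blast
  then have "s \<in> Idl (insert x B)" using nonzerodivisor_modD[OF z] s by blast
  then obtain j t where t: "j \<in> Idl B" "t \<in> carrier R" "s = j \<oplus> x \<otimes> t"
    unfolding Idl_insert[OF B xz(1)] by blast
  have j: "j \<in> carrier R" using t B.Icarr by blast
  have "x \<otimes> (r \<ominus> z \<otimes> t) = x \<otimes> r \<ominus> z \<otimes> (x \<otimes> t)"
    using r t xz by algebra
  also have "\<dots> = i \<oplus> z \<otimes> j"
    unfolding s(3) t(3) using i j r t xz by algebra
  also have "\<dots> \<in> Idl B" using s t xz by (intro B.add_mem B.I_l_closed)
  finally have "r \<ominus> z \<otimes> t \<in> Idl B" using nonzerodivisor_modD[OF x, of "r \<ominus> z \<otimes> t"] r t xz by simp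
  moreover have "r = (r \<ominus> z \<otimes> t) \<oplus> z \<otimes> t" using r t xz by algebra
  ultimately show "r \<in> Idl (insert z B)"
    unfolding Idl_insert[OF B xz(2)] using t by blast
qed

text \<open>Repeated use of \<open>nonzerodivisor_mod_swap\<close> moves \<open>z\<close> from
  behind the initial segments of \<open>xs\<close> to the front of the sequence.\<close>

lemma regular_over_insert:
  assumes "B \<subseteq> carrier R" "set xs \<subseteq> carrier R" "z \<in> carrier R"
    and "regular_over R B xs"
    and "\<And>i. i \<le> length xs \<Longrightarrow> nonzerodivisor_mod R (Idl (set (take i xs) \<union> B)) z"
  shows "regular_over R (insert z B) xs"
  using assms
proof (induct xs arbitrary: B)
  case (Cons x xs)
  have z: "nonzerodivisor_mod R (Idl (set (take i xs) \<union> insert x B)) z" if "i \<le> length xs" for i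
    using Cons.prems(5)[of "Suc i"] that by simp
  have "nonzerodivisor_mod R (Idl (insert z B)) x"
    using Cons.prems z[of 0] by (intro nonzerodivisor_mod_swap[of B x z]) auto
  moreover have "regular_over R (insert z (insert x B)) xs"
    using Cons.prems z by (intro Cons.hyps) auto
  ultimately show ?case by (simp add: insert_commute)
qed simp

text \<open>For a maximal ideal \<open>M\<close> this says \<open>Hom(R/M, R/I) \<noteq> 0\<close>.\<close>

definition has_socle :: "'a set \<Rightarrow> 'a set \<Rightarrow> bool"
  where "has_socle M I \<longleftrightarrow> (\<exists>a\<in>carrier R. a \<notin> I \<and> (\<forall>m\<in>M. m \<otimes> a \<in> I))"

text \<open>For an ideal \<open>M\<close>, both socles \<open>Hom(R/M, R/(B, x))\<close> and
  \<open>Hom(R/M, R/(B, y))\<close> are isomorphic to \<open>Ext^1(R/M, R/(B))\<close>. Concretely,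
  \<open>a\<close> corresponds to the \<open>b\<close> with \<open>y a = x b\<close> modulo
  \<open>(B)\<close>, which exists because \<open>y\<close> lies in \<open>M\<close>.\<close>

lemma has_socle_exchange:
  assumes B: "B \<subseteq> carrier R" and M: "M \<subseteq> carrier R" and xy: "x \<in> M" "y \<in> M"
    and x: "nonzerodivisor_mod R (Idl B) x" and y: "nonzerodivisor_mod R (Idl B) y"
    and soc: "has_socle M (Idl (insert x B))"
  shows "has_socle M (Idl (insert y B))"
proof -
  interpret B: ideal "Idl B" R using genideal_ideal[OF B] .
  have xc: "x \<in> carrier R" and yc: "y \<in> carrier R" using M xy by auto
  note Ix = Idl_insert[OF B xc] and Iy = Idl_insert[OF B yc]
  obtain a where a: "a \<in> carrier R" "a \<notin> Idl (insert x B)"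
    "\<And>m. m \<in> M \<Longrightarrow> m \<otimes> a \<in> Idl (insert x B)"
    using soc unfolding has_socle_def by blast
  obtain i b where b: "i \<in> Idl B" "b \<in> carrier R" "y \<otimes> a = i \<oplus> x \<otimes> b"
    using a(3)[OF xy(2)] unfolding Ix by blast
  have i: "i \<in> carrier R" using b B.Icarr by blast
  have "b \<notin> Idl (insert y B)"
  proof
    assume "b \<in> Idl (insert y B)"
    then obtain j c where c: "j \<in> Idl B" "c \<in> carrier R" "b = j \<oplus> y \<otimes> c"
      unfolding Iy by blast
    have j: "j \<in> carrier R" using c B.Icarr by blast
    have "y \<otimes> (a \<ominus> x \<otimes> c) = y \<otimes> a \<ominus> x \<otimes> (y \<otimes> c)"
      using a c xc yc by algebra
    also have "\<dots> = i \<oplus> x \<otimes> j"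
      unfolding b(3) c(3) using i j c xc yc by algebra
    also have "\<dots> \<in> Idl B" using b c xc by (intro B.add_mem B.I_l_closed)
    finally have "a \<ominus> x \<otimes> c \<in> Idl B" using nonzerodivisor_modD[OF y, of "a \<ominus> x \<otimes> c"] a c xc by simp
    moreover have "a = (a \<ominus> x \<otimes> c) \<oplus> x \<otimes> c" using a c xc by algebra
    ultimately show False using a(2) c unfolding Ix by blast
  qed
  moreover have "m \<otimes> b \<in> Idl (insert y B)" if m: "m \<in> M" for m
  proof -
    have mc: "m \<in> carrier R" using m M by blast
    obtain j c where c: "j \<in> Idl B" "c \<in> carrier R" "m \<otimes> a = j \<oplus> x \<otimes> c"
      using a(3)[OF m] unfolding Ix by blast
    have j: "j \<in> carrier R" using c B.Icarr by blast
    \<comment> \<open>Modulo the base ideal \<open>x b\<close> equals \<open>y a\<close> and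
      \<open>x c\<close> equals \<open>m a\<close>, so the common term \<open>y m a\<close> cancels
      and only multiples of \<open>i\<close> and \<open>j\<close> remain.\<close>
    have "x \<otimes> (m \<otimes> b \<ominus> y \<otimes> c) = m \<otimes> ((i \<oplus> x \<otimes> b) \<ominus> i) \<ominus> y \<otimes> (x \<otimes> c)"
      using b i c mc xc yc by algebra
    also have "\<dots> = y \<otimes> (m \<otimes> a) \<ominus> m \<otimes> i \<ominus> y \<otimes> (x \<otimes> c)"
      unfolding b(3)[symmetric] using a(1) i c(2) mc xc yc by algebra
    also have "\<dots> = y \<otimes> j \<ominus> m \<otimes> i"
      unfolding c(3) using i j c(2) mc xc yc by algebra
    also have "\<dots> \<in> Idl B" using b c mc yc by (intro B.a_minus_closed B.I_l_closed)
    finally have "m \<otimes> b \<ominus> y \<otimes> c \<in> Idl B"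
      using nonzerodivisor_modD[OF x, of "m \<otimes> b \<ominus> y \<otimes> c"] b c mc yc by simp
    moreover have "m \<otimes> b = (m \<otimes> b \<ominus> y \<otimes> c) \<oplus> y \<otimes> c" using b c mc yc by algebra
    ultimately show ?thesis unfolding Iy using c by blast
  qed
  ultimately show ?thesis unfolding has_socle_def using b by blast
qed

end

section \<open>Zerodivisors and Rees' theorem over noetherian rings\<close>

locale noetherian_cring = noetherian_ring + cring
begin

text \<open>The zerodivisors modulo \<open>I\<close> form the union of the maximal members of the family of colon
  ideals \<open>I : a\<close>; these are prime, and only finitely many because the elements \<open>a\<close> they belong
  to generate a finitely generated ideal.\<close>

lemma zerodivisors_mod_prime_cover:
  assumes I: "ideal I R"
  obtains F where "finite F"
    "\<And>P. P \<in> F \<Longrightarrow> primeideal P R \<and> (\<exists>a\<in>carrier R. a \<notin> I \<and> (\<forall>p\<in>P. p \<otimes> a \<in> I))"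
    "\<And>x. x \<in> carrier R \<Longrightarrow> \<not> nonzerodivisor_mod R I x \<longleftrightarrow> x \<in> \<Union>F"
proof -
  interpret I: ideal I R by fact
  define c where "c a = {r \<in> carrier R. r \<otimes> a \<in> I}" for a
  define A where "A = carrier R - I"
  have cid: "ideal (c a) R" if "a \<in> A" for a
    using that I colon_ideal unfolding c_def A_def by blast
  define T where "T = {a \<in> A. \<forall>b\<in>A. c a \<subseteq> c b \<longrightarrow> c b = c a}"
  have TA: "T \<subseteq> A" "T \<subseteq> carrier R" unfolding T_def A_def by auto
  have top: "\<exists>t\<in>T. c a \<subseteq> c t" if "a \<in> A" for a
  proof -
    have "\<exists>M\<in>{c b | b. b \<in> A \<and> c a \<subseteq> c b}. \<forall>J\<in>{c b | b. b \<in> A \<and> c a \<subseteq> c b}. M \<subseteq> J \<longrightarrow> J = M"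
      using that cid by (intro exists_maximal_in_family) auto
    then obtain b where b: "b \<in> A" "c a \<subseteq> c b"
      "\<And>J. J \<in> {c b | b. b \<in> A \<and> c a \<subseteq> c b} \<Longrightarrow> c b \<subseteq> J \<Longrightarrow> J = c b"
      by auto
    have "c b' = c b" if "b' \<in> A" "c b \<subseteq> c b'" for b'
      using that b(2) by (intro b(3)) auto
    then show ?thesis using b unfolding T_def by auto
  qed
  have prime: "primeideal (c a) R" if a: "a \<in> T" for a
  proof (rule primeidealI)
    have aA: "a \<in> A" "a \<in> carrier R" "a \<notin> I" using a TA by (auto simp: A_def)
    show "ideal (c a) R" using cid aA by blast
    show "carrier R \<noteq> c a"
      using aA unfolding c_def by (metis (no_types, lifting) l_one mem_Collect_eq one_closed)
    fix x y assume xy: "x \<in> carrier R" "y \<in> carrier R" "x \<otimes> y \<in> c a"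
    show "x \<in> c a \<or> y \<in> c a"
    proof (cases "y \<otimes> a \<in> I")
      case False
      \<comment> \<open>The colon ideal of \<open>y a\<close> contains that of \<open>a\<close>,
        hence equals it by maximality; and \<open>x\<close> belongs to it.\<close>
      then have "y \<otimes> a \<in> A" using xy aA by (simp add: A_def)
      moreover have "c a \<subseteq> c (y \<otimes> a)"
      proof
        fix r assume r: "r \<in> c a"
        then have "r \<otimes> (y \<otimes> a) = y \<otimes> (r \<otimes> a)"
          using xy aA by (simp add: c_def m_lcomm)
        moreover have "\<dots> \<in> I" using r xy by (simp add: c_def I.I_l_closed)
        ultimately show "r \<in> c (y \<otimes> a)" using r by (simp add: c_def)
      qed
      ultimately have "c (y \<otimes> a) = c a" using a by (auto simp: T_def)
      moreover have "x \<in> c (y \<otimes> a)" using xy aA by (auto simp: c_def m_assoc)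
      ultimately show ?thesis by simp
    qed (use xy in \<open>simp add: c_def\<close>)
  qed (rule is_cring)
  obtain T0 where T0: "finite T0" "T0 \<subseteq> T" "Idl T0 = Idl T"
    using Idl_finite_subset[OF TA(2)] .
  \<comment> \<open>If no \<open>c s\<close> with \<open>s\<close> in \<open>T0\<close> lay inside
    \<open>c t\<close>, choose \<open>r s\<close> in \<open>c s\<close> outside \<open>c t\<close>.
    Their product \<open>p\<close> stays outside the prime \<open>c t\<close>, yet it multiplies
    \<open>T0\<close>, hence the ideal generated by \<open>T\<close>, hence \<open>t\<close>, into
    \<open>I\<close>.\<close>
  have fin: "c t \<in> c ` T0" if t: "t \<in> T" for t
  proof -
    interpret P: primeideal "c t" R using prime[OF t] .
    have tA: "t \<in> carrier R" "t \<notin> I" using t TA by (auto simp: A_def)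
    have "\<exists>s\<in>T0. c s \<subseteq> c t"
    proof (rule ccontr)
      assume "\<not> ?thesis"
      then have "\<forall>s\<in>T0. \<exists>r. r \<in> c s \<and> r \<notin> c t" by blast
      then obtain r where r: "\<And>s. s \<in> T0 \<Longrightarrow> r s \<in> c s" "\<And>s. s \<in> T0 \<Longrightarrow> r s \<notin> c t" by metis
      have rc: "r \<in> T0 \<rightarrow> carrier R" using r(1) unfolding c_def by blast
      define p where "p = finprod R r T0"
      have pc: "p \<in> carrier R" using rc p_def by simp
      have "p \<notin> c t" using P.finprod_mem[OF T0(1) rc] r(2) p_def by blast
      have "T0 \<subseteq> {q \<in> carrier R. q \<otimes> p \<in> I}"
      proof
        fix s assume s: "s \<in> T0"
        define q where "q = finprod R r (T0 - {s})"
        have q: "q \<in> carrier R" unfolding q_def using rc by (intro finprod_closed) auto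
        have sc: "s \<in> carrier R" "r s \<in> carrier R"
          using s T0(2) TA(2) rc by auto
        have "p = r s \<otimes> q"
          unfolding p_def q_def using T0(1) s rc
          by (subst finprod_insert[symmetric]) (auto simp: insert_absorb)
        then have "s \<otimes> p = (r s \<otimes> s) \<otimes> q" using q sc by (simp add: m_ac)
        moreover have "r s \<otimes> s \<in> I" using r(1)[OF s] unfolding c_def by blast
        ultimately show "s \<in> {q \<in> carrier R. q \<otimes> p \<in> I}"
          using q sc pc I.I_r_closed by simp
      qed
      then have "Idl T0 \<subseteq> {q \<in> carrier R. q \<otimes> p \<in> I}"
        using colon_ideal[OF I pc] genideal_minimal by blast
      moreover have "t \<in> Idl T0" using T0(3) genideal_self[OF TA(2)] t by blast
      ultimately have "t \<otimes> p \<in> I" by blast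
      then have "p \<otimes> t \<in> I" using m_comm[OF pc tA(1)] by metis
      then show False using \<open>p \<notin> c t\<close> pc unfolding c_def by blast
    qed
    then obtain s where "s \<in> T0" "c s \<subseteq> c t" by blast
    moreover from this have "c t = c s" using t T0(2) TA by (auto simp: T_def)
    ultimately show ?thesis by blast
  qed
  show thesis
  proof (rule that[of "c ` T0"])
    show "finite (c ` T0)" using T0 by simp
    fix P assume "P \<in> c ` T0"
    then obtain t where t: "t \<in> T0" "P = c t" by blast
    then have "primeideal P R" using prime T0 by blast
    moreover have "t \<in> carrier R" "t \<notin> I" using t T0 TA by (auto simp: A_def)
    ultimately show "primeideal P R \<and> (\<exists>a\<in>carrier R. a \<notin> I \<and> (\<forall>p\<in>P. p \<otimes> a \<in> I))"
      using t by (auto simp: c_def)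
  next
    fix x assume x: "x \<in> carrier R"
    show "\<not> nonzerodivisor_mod R I x \<longleftrightarrow> x \<in> \<Union>(c ` T0)"
    proof
      assume "\<not> nonzerodivisor_mod R I x"
      then obtain a where a: "a \<in> A" "x \<in> c a"
        using x by (auto simp: nonzerodivisor_mod_def A_def c_def)
      then obtain t where "t \<in> T" "c a \<subseteq> c t" using top by blast
      then show "x \<in> \<Union>(c ` T0)" using fin a by (metis UnionI subsetD)
    next
      assume "x \<in> \<Union>(c ` T0)"
      then obtain t where "t \<in> T0" "x \<otimes> t \<in> I" by (auto simp: c_def)
      then show "\<not> nonzerodivisor_mod R I x"
        using T0 TA by (auto simp: nonzerodivisor_mod_def A_def)
    qed
  qed
qed

text \<open>Prime avoidance for the union of the finite prime covers belonging to the various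
  \<open>I\<close>: \<open>M\<close> lies in none of these primes, since for each \<open>I\<close>
  it contains an element outside all primes of the cover for \<open>I\<close>.\<close>

lemma common_nonzerodivisor:
  assumes M: "ideal M R" and F: "finite F" "\<And>I. I \<in> F \<Longrightarrow> ideal I R"
    and x: "\<And>I. I \<in> F \<Longrightarrow> \<exists>x\<in>M. nonzerodivisor_mod R I x"
  obtains z where "z \<in> M" "\<And>I. I \<in> F \<Longrightarrow> nonzerodivisor_mod R I z"
proof -
  interpret M: ideal M R by fact
  have "\<forall>I\<in>F. \<exists>E. finite E \<and> (\<forall>P\<in>E. primeideal P R) \<and>
      (\<forall>x\<in>carrier R. \<not> nonzerodivisor_mod R I x \<longleftrightarrow> x \<in> \<Union>E)"
    using F(2) zerodivisors_mod_prime_cover by metis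
  then obtain E where E: "\<And>I. I \<in> F \<Longrightarrow> finite (E I)"
    "\<And>I P. I \<in> F \<Longrightarrow> P \<in> E I \<Longrightarrow> primeideal P R"
    "\<And>I x. I \<in> F \<Longrightarrow> x \<in> carrier R \<Longrightarrow> \<not> nonzerodivisor_mod R I x \<longleftrightarrow> x \<in> \<Union>(E I)"
    by metis
  have "\<not> M \<subseteq> \<Union>(\<Union>(E ` F))"
  proof
    assume "M \<subseteq> \<Union>(\<Union>(E ` F))"
    then have "\<exists>P\<in>\<Union>(E ` F). M \<subseteq> P"
      using F(1) E(1,2) by (intro prime_avoidance[OF M]) auto
    then obtain I P where P: "I \<in> F" "P \<in> E I" "M \<subseteq> P" by blast
    obtain x where "x \<in> M" "nonzerodivisor_mod R I x" using x[OF P(1)] by blast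
    then show False using E(3)[OF P(1), of x] P M.Icarr by blast
  qed
  then obtain z where z: "z \<in> M" "z \<notin> \<Union>(\<Union>(E ` F))" by blast
  show thesis
  proof (rule that[OF z(1)])
    fix I assume "I \<in> F"
    then show "nonzerodivisor_mod R I z"
      using E(3)[of I z] z M.Icarr[OF z(1)] by auto
  qed
qed

text \<open>Prime avoidance places \<open>M\<close> inside one prime of the cover, and that prime
  multiplies a single element outside \<open>I\<close> into \<open>I\<close>.\<close>

lemma has_socle_if_all_zerodivisors:
  assumes M: "ideal M R" and I: "ideal I R"
    and zd: "\<And>x. x \<in> M \<Longrightarrow> \<not> nonzerodivisor_mod R I x"
  shows "has_socle M I"
proof -
  obtain F where F: "finite F"
    "\<And>P. P \<in> F \<Longrightarrow> primeideal P R \<and> (\<exists>a\<in>carrier R. a \<notin> I \<and> (\<forall>p\<in>P. p \<otimes> a \<in> I))"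
    "\<And>x. x \<in> carrier R \<Longrightarrow> \<not> nonzerodivisor_mod R I x \<longleftrightarrow> x \<in> \<Union>F"
    using zerodivisors_mod_prime_cover[OF I] by metis
  have "M \<subseteq> \<Union>F" using F(3) zd ideal.Icarr[OF M] by blast
  then have "\<exists>P\<in>F. M \<subseteq> P" using F by (intro prime_avoidance[OF M]) auto
  then show ?thesis unfolding has_socle_def using F(2) by blast
qed

text \<open>Rees' theorem: both sequences are exchanged, in their last place, for a common \<open>z\<close>, which is
  then moved to the front and absorbed in the base set \<open>B\<close>.\<close>

lemma has_socle_regular_over:
  assumes M: "ideal M R" and "B \<subseteq> carrier R" "length xs = length ys"
    and "set xs \<subseteq> M" "set ys \<subseteq> M" "regular_over R B xs" "regular_over R B ys"
    and "has_socle M (Idl (set xs \<union> B))"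
  shows "has_socle M (Idl (set ys \<union> B))"
  using assms(2-)
proof (induct "length xs" arbitrary: xs ys B)
  case (Suc n)
  have Mc: "M \<subseteq> carrier R" using ideal.Icarr[OF M] by blast
  obtain us x where us: "xs = us @ [x]" "length us = n"
    using Suc.hyps(2) by (metis length_Suc_conv_rev)
  obtain vs y where vs: "ys = vs @ [y]" "length vs = n"
    using Suc.hyps(2) Suc.prems(2) by (metis length_Suc_conv_rev)
  have reg: "regular_over R B us" "nonzerodivisor_mod R (Idl (set us \<union> B)) x"
    "regular_over R B vs" "nonzerodivisor_mod R (Idl (set vs \<union> B)) y"
    using Suc.prems(5,6) unfolding us(1) vs(1) regular_over_append by simp_all
  have sub: "set us \<subseteq> M" "x \<in> M" "set vs \<subseteq> M" "y \<in> M"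
    using Suc.prems(3,4) unfolding us(1) vs(1) by simp_all
  \<comment> \<open>The indices up to \<open>n\<close> give all proper initial segments, the longest
    being \<open>us\<close> and \<open>vs\<close>. Modulo each of them the next entry of the
    sequence is a nonzerodivisor in \<open>M\<close>, so a common \<open>z\<close> exists.\<close>
  define F where "F = (\<lambda>i. Idl (set (take i xs) \<union> B)) ` {..<Suc n}
      \<union> (\<lambda>i. Idl (set (take i ys) \<union> B)) ` {..<Suc n}"
  have "finite F" by (simp add: F_def)
  moreover have "ideal I R" if "I \<in> F" for I
  proof -
    have "set (take i xs) \<union> B \<subseteq> carrier R" "set (take i ys) \<union> B \<subseteq> carrier R" for i
      using Suc.prems(1,3,4) Mc set_take_subset by fast+
    then show ?thesis using that genideal_ideal by (auto simp: F_def)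
  qed
  moreover have "\<exists>m\<in>M. nonzerodivisor_mod R I m" if "I \<in> F" for I
  proof -
    have "xs ! i \<in> M" "ys ! i \<in> M" if "i < Suc n" for i
      using that Suc.hyps(2) Suc.prems(2,3,4) by auto
    then show ?thesis
      using that Suc.hyps(2) Suc.prems(2,5,6) unfolding F_def regular_over_iff_nth by auto
  qed
  ultimately obtain z where z: "z \<in> M" "\<And>I. I \<in> F \<Longrightarrow> nonzerodivisor_mod R I z"
    using common_nonzerodivisor[OF M] by metis
  have zx: "nonzerodivisor_mod R (Idl (set (take i us) \<union> B)) z"
    and zy: "nonzerodivisor_mod R (Idl (set (take i vs) \<union> B)) z" if "i \<le> n" for i
  proof -
    have "take i us = take i xs" "take i vs = take i ys" using that us vs by auto
    then show "nonzerodivisor_mod R (Idl (set (take i us) \<union> B)) z"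
      "nonzerodivisor_mod R (Idl (set (take i vs) \<union> B)) z"
      using that by (auto intro!: z(2) simp: F_def)
  qed
  have "has_socle M (Idl (insert z (set us \<union> B)))"
    using Suc.prems(1,7) sub Mc z(1) reg(2) zx[of n] us
    by (intro has_socle_exchange[of "set us \<union> B" M x z]) auto
  moreover have Bz: "insert z B \<subseteq> carrier R" using Suc.prems(1) z(1) Mc by blast
  moreover have "regular_over R (insert z B) us" "regular_over R (insert z B) vs"
    by (rule regular_over_insert;
        use Suc.prems(1) sub Mc z(1) reg zx zy us(2) vs(2) in \<open>simp add: subset_iff\<close>)+
  \<comment> \<open>With \<open>z\<close> in the base, the induction hypothesis passes from
    \<open>us\<close> to \<open>vs\<close>; a last exchange then trades \<open>z\<close> for
    \<open>y\<close>.\<close>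
  ultimately have "has_socle M (Idl (set vs \<union> insert z B))"
    using us(2) vs(2) sub Bz
    by - (rule Suc.hyps(1)[of us], simp_all)
  moreover have Vs: "set vs \<union> B \<subseteq> carrier R" using Suc.prems(1) sub(3) Mc by blast
  ultimately show ?case
    using has_socle_exchange[of "set vs \<union> B" M z y] Vs Mc z(1) sub(4) reg(4) zy[of n] vs
    by simp
qed simp

text \<open>Otherwise \<open>M\<close> has a socle modulo \<open>xs\<close>, hence by
  \<open>has_socle_regular_over\<close> also modulo the first \<open>k\<close> entries of
  \<open>ys\<close>. This is impossible, as the next entry of \<open>ys\<close> lies in
  \<open>M\<close> and is a nonzerodivisor there.\<close>

lemma regular_sequence_extend:
  assumes M: "ideal M R" and xs: "regular_over R {} xs" "set xs \<subseteq> M"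
    and ys: "regular_over R {} ys" "set ys \<subseteq> M" and less: "length xs < length ys"
  shows "\<exists>z\<in>M. nonzerodivisor_mod R (Idl (set xs)) z"
proof (rule ccontr)
  assume none: "\<not> ?thesis"
  define k where "k = length xs"
  have Mc: "M \<subseteq> carrier R" using ideal.Icarr[OF M] by blast
  have "has_socle M (Idl (set xs))"
  proof (rule has_socle_if_all_zerodivisors[OF M])
    show "ideal (Idl (set xs)) R" using xs(2) Mc by (intro genideal_ideal) simp
      fix x assume "x \<in> M"
    from none this show "\<not> nonzerodivisor_mod R (Idl (set xs)) x"
      by simp
  qed
  moreover have split: "ys = take k ys @ ys ! k # drop (Suc k) ys"
    using less by (simp add: k_def id_take_nth_drop)
  moreover have reg: "regular_over R {} (take k ys)"
    "nonzerodivisor_mod R (Idl (set (take k ys))) (ys ! k)"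
    using ys(1) by (subst (asm) split, simp add: regular_over_append)+
  ultimately have "has_socle M (Idl (set (take k ys)))"
    using has_socle_regular_over[OF M, of "{}" xs "take k ys"] xs ys(2) less
      set_take_subset[of k ys] by (auto simp: k_def)
  then obtain a where a: "a \<in> carrier R" "a \<notin> Idl (set (take k ys))"
    "ys ! k \<otimes> a \<in> Idl (set (take k ys))"
    using ys(2) less nth_mem[of k ys] unfolding has_socle_def k_def by blast
  then show False using nonzerodivisor_modD[OF reg(2)] by blast
qed

end

section \<open>Invariants of a finite group action\<close>

locale finite_ring_action = ring_action +
  assumes finite_group: "finite (carrier G)"
begin

abbreviation A where "A \<equiv> invariant_ring G R \<phi>"

lemma carrier_invariant_ring:
  "carrier A = {r \<in> carrier R. \<forall>g\<in>carrier G. \<phi> g r = r}"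
  by (simp add: invariant_ring_def)

lemma invariant_ring_simps [simp]:
  "x \<otimes>\<^bsub>A\<^esub> y = x \<otimes> y" "x \<oplus>\<^bsub>A\<^esub> y = x \<oplus> y" "\<one>\<^bsub>A\<^esub> = \<one>" "\<zero>\<^bsub>A\<^esub> = \<zero>"
  by (simp_all add: invariant_ring_def)

lemma group_G: "group G"
  using group_hom group_hom.axioms(1) by blast

lemma action_hom: "g \<in> carrier G \<Longrightarrow> ring_hom_cring R R (\<phi> g)"
  using ring_automorphism is_cring
  by (auto simp: ring_iso_def ring_hom_cring_def ring_hom_cring_axioms_def)

lemma action_closed [simp]: "g \<in> carrier G \<Longrightarrow> r \<in> carrier R \<Longrightarrow> \<phi> g r \<in> carrier R"
  using element_image by blast

lemma action_simps [simp]: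
  assumes "g \<in> carrier G"
  shows "\<phi> g \<zero> = \<zero>" "\<phi> g \<one> = \<one>"
    and "a \<in> carrier R \<Longrightarrow> b \<in> carrier R \<Longrightarrow> \<phi> g (a \<oplus> b) = \<phi> g a \<oplus> \<phi> g b"
    and "a \<in> carrier R \<Longrightarrow> b \<in> carrier R \<Longrightarrow> \<phi> g (a \<otimes> b) = \<phi> g a \<otimes> \<phi> g b"
    and "a \<in> carrier R \<Longrightarrow> \<phi> g (\<ominus> a) = \<ominus> \<phi> g a"
proof -
  interpret h: ring_hom_cring R R "\<phi> g" using action_hom[OF assms] .
  show "\<phi> g \<zero> = \<zero>" "\<phi> g \<one> = \<one>"
    "a \<in> carrier R \<Longrightarrow> b \<in> carrier R \<Longrightarrow> \<phi> g (a \<oplus> b) = \<phi> g a \<oplus> \<phi> g b"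
    "a \<in> carrier R \<Longrightarrow> b \<in> carrier R \<Longrightarrow> \<phi> g (a \<otimes> b) = \<phi> g a \<otimes> \<phi> g b"
    "a \<in> carrier R \<Longrightarrow> \<phi> g (\<ominus> a) = \<ominus> \<phi> g a"
    by simp_all
qed

lemma action_one [simp]: "r \<in> carrier R \<Longrightarrow> \<phi> \<one>\<^bsub>G\<^esub> r = r"
  using id_eq_one by (metis restrict_apply)

lemma action_inv [simp]:
  assumes "g \<in> carrier G" "r \<in> carrier R"
  shows "\<phi> (inv\<^bsub>G\<^esub> g) (\<phi> g r) = r" "\<phi> g (\<phi> (inv\<^bsub>G\<^esub> g) r) = r"
proof -
  interpret group G by (rule group_G)
  show "\<phi> (inv\<^bsub>G\<^esub> g) (\<phi> g r) = r" "\<phi> g (\<phi> (inv\<^bsub>G\<^esub> g) r) = r"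
    using composition_rule[of r "inv\<^bsub>G\<^esub> g" g] composition_rule[of r g "inv\<^bsub>G\<^esub> g"] assms by simp_all
qed

lemma action_translate:
  assumes "h \<in> carrier G"
  shows "inj_on (\<lambda>g. h \<otimes>\<^bsub>G\<^esub> g) (carrier G)" "(\<lambda>g. h \<otimes>\<^bsub>G\<^esub> g) ` carrier G = carrier G"
proof -
  interpret group G by (rule group_G)
  show "inj_on (\<lambda>g. h \<otimes>\<^bsub>G\<^esub> g) (carrier G)" using assms by (intro inj_onI) simp
  show "(\<lambda>g. h \<otimes>\<^bsub>G\<^esub> g) ` carrier G = carrier G" using surj_const_mult[OF assms] .
qed

lemma invariantD:
  assumes "a \<in> carrier A"
  shows "a \<in> carrier R" "g \<in> carrier G \<Longrightarrow> \<phi> g a = a"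
  using assms by (auto simp: carrier_invariant_ring)

lemma invariant_closed:
  "\<zero> \<in> carrier A" "\<one> \<in> carrier A"
  "a \<in> carrier A \<Longrightarrow> b \<in> carrier A \<Longrightarrow> a \<oplus> b \<in> carrier A"
  "a \<in> carrier A \<Longrightarrow> b \<in> carrier A \<Longrightarrow> a \<otimes> b \<in> carrier A"
  "a \<in> carrier A \<Longrightarrow> \<ominus> a \<in> carrier A"
  "a \<in> carrier A \<Longrightarrow> b \<in> carrier A \<Longrightarrow> a \<ominus> b \<in> carrier A"
  by (auto simp: carrier_invariant_ring a_minus_def)

lemma invariant_ring_cring: "cring A"
proof -
  have "subring (carrier A) R"
    by (rule subringI) (auto intro: invariant_closed invariantD)
  then have "subcring (carrier A) R"
    using subcringI' by blast
  then have "cring (R\<lparr>carrier := carrier A\<rparr>)"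
    using subcring_iff invariantD(1) by blast
  then show ?thesis by (simp add: invariant_ring_def)
qed

lemma invariant_ideal_if_closed:
  assumes "I \<subseteq> carrier A" "\<zero> \<in> I"
    and "\<And>a b. a \<in> I \<Longrightarrow> b \<in> I \<Longrightarrow> a \<oplus> b \<in> I"
    and "\<And>a r. a \<in> I \<Longrightarrow> r \<in> carrier A \<Longrightarrow> r \<otimes> a \<in> I"
  shows "ideal I A"
  using cring.ideal_if_closed[OF invariant_ring_cring, of I] assms by simp

lemma invariant_idealD:
  assumes "ideal I A"
  shows "a \<in> I \<Longrightarrow> a \<in> carrier A" "\<zero> \<in> I" "a \<in> I \<Longrightarrow> b \<in> I \<Longrightarrow> a \<oplus> b \<in> I"
    "a \<in> I \<Longrightarrow> r \<in> carrier A \<Longrightarrow> r \<otimes> a \<in> I"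
  using ideal.Icarr[OF assms] additive_subgroup.zero_closed[OF ideal.axioms(1)[OF assms]]
    ideal.add_mem[OF assms] ideal.I_l_closed[OF assms] by simp_all

lemma contraction_ideal:
  assumes "ideal I R"
  shows "ideal (I \<inter> carrier A) A"
proof -
  interpret ideal I R by fact
  show ?thesis
    by (rule invariant_ideal_if_closed)
      (auto intro: invariant_closed add_mem I_l_closed invariantD)
qed

lemma contraction_primeideal:
  assumes "primeideal P R"
  shows "primeideal (P \<inter> carrier A) A"
proof -
  interpret P: primeideal P R by fact
  show ?thesis
  proof (rule primeidealI[OF contraction_ideal[OF P.is_ideal] invariant_ring_cring])
    show "carrier A \<noteq> P \<inter> carrier A"
      using P.one_imp_carrier P.I_notcarr invariant_closed(2) by auto
    fix a b assume "a \<in> carrier A" "b \<in> carrier A" "a \<otimes>\<^bsub>A\<^esub> b \<in> P \<inter> carrier A"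
    then show "a \<in> P \<inter> carrier A \<or> b \<in> P \<inter> carrier A"
      using P.I_prime[of a b] invariantD(1) by auto
  qed
qed

text \<open>Translates are written as preimages: this is the image of \<open>I\<close> under the
  inverse of \<open>g\<close>.\<close>

lemma translate_ideal:
  assumes "g \<in> carrier G" "ideal I R"
  shows "ideal {r \<in> carrier R. \<phi> g r \<in> I} R"
proof -
  interpret ideal I R by fact
  show ?thesis
    by (rule ideal_if_closed) (use assms(1) in \<open>auto intro: add_mem I_l_closed\<close>)
qed

lemma translate_primeideal:
  assumes "g \<in> carrier G" "primeideal P R"
  shows "primeideal {r \<in> carrier R. \<phi> g r \<in> P} R"
proof -
  interpret P: primeideal P R by fact
  show ?thesis
  proof (rule primeidealI[OF translate_ideal[OF assms(1) P.is_ideal] is_cring])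
    have "\<one> \<notin> {r \<in> carrier R. \<phi> g r \<in> P}"
      using P.one_imp_carrier P.I_notcarr action_simps(2)[OF assms(1)] by auto
    then show "carrier R \<noteq> {r \<in> carrier R. \<phi> g r \<in> P}" by blast
  qed (use assms(1) P.I_prime in auto)
qed

section \<open>Trace and norm\<close>

definition trace :: "'c \<Rightarrow> 'c"
  where "trace r = (\<Oplus>g\<in>carrier G. \<phi> g r)"

definition norm :: "'c \<Rightarrow> 'c"
  where "norm r = (\<Otimes>g\<in>carrier G. \<phi> g r)"

lemma trace_closed [simp]: "r \<in> carrier R \<Longrightarrow> trace r \<in> carrier R"
  unfolding trace_def by (rule finsum_closed) auto

lemma trace_invariant:
  assumes r: "r \<in> carrier R"
  shows "trace r \<in> carrier A"
proof -
  have "\<phi> h (trace r) = trace r" if h: "h \<in> carrier G" for h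
  proof -
    interpret hom: ring_hom_cring R R "\<phi> h" using action_hom[OF h] .
    have "\<phi> h (trace r) = (\<Oplus>g\<in>carrier G. \<phi> h (\<phi> g r))"
      unfolding trace_def using r by (subst hom.hom_finsum) (auto simp: o_def)
    also have "\<dots> = (\<Oplus>g\<in>carrier G. \<phi> (h \<otimes>\<^bsub>G\<^esub> g) r)"
      using r h by (intro finsum_cong') (auto simp: composition_rule)
    also have "\<dots> = (\<Oplus>g\<in>(\<lambda>g. h \<otimes>\<^bsub>G\<^esub> g) ` carrier G. \<phi> g r)"
      using r action_translate[OF h] by (subst finsum_reindex) auto
    finally show ?thesis unfolding trace_def action_translate(2)[OF h] .
  qed
  then show ?thesis using r by (simp add: carrier_invariant_ring)
qed

lemma norm_invariant:
  assumes r: "r \<in> carrier R"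
  shows "norm r \<in> carrier A"
proof -
  have "\<phi> h (norm r) = norm r" if h: "h \<in> carrier G" for h
  proof -
    interpret hom: ring_hom_cring R R "\<phi> h" using action_hom[OF h] .
    have "\<phi> h (norm r) = (\<Otimes>g\<in>carrier G. \<phi> h (\<phi> g r))"
      unfolding norm_def using r by (subst hom.hom_finprod) (auto simp: o_def)
    also have "\<dots> = (\<Otimes>g\<in>carrier G. \<phi> (h \<otimes>\<^bsub>G\<^esub> g) r)"
      using r h by (intro finprod_cong') (auto simp: composition_rule)
    also have "\<dots> = (\<Otimes>g\<in>(\<lambda>g. h \<otimes>\<^bsub>G\<^esub> g) ` carrier G. \<phi> g r)"
      using r action_translate[OF h] by (subst finprod_reindex) auto
    finally show ?thesis unfolding norm_def action_translate(2)[OF h] .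
  qed
  moreover have "norm r \<in> carrier R" unfolding norm_def using r by (intro finprod_closed) auto
  ultimately show ?thesis by (simp add: carrier_invariant_ring)
qed

text \<open>The factor of the norm at the identity is \<open>r\<close> itself.\<close>

lemma norm_mem:
  assumes "ideal I R" "r \<in> I"
  shows "norm r \<in> I"
proof -
  interpret I: ideal I R by fact
  interpret G: group G by (rule group_G)
  have r: "r \<in> carrier R" using assms I.Icarr by blast
  have "norm r = finprod R (\<lambda>g. \<phi> g r) (insert \<one>\<^bsub>G\<^esub> (carrier G - {\<one>\<^bsub>G\<^esub>}))"
    unfolding norm_def by (simp add: insert_absorb)
  also have "\<dots> = \<phi> \<one>\<^bsub>G\<^esub> r \<otimes> finprod R (\<lambda>g. \<phi> g r) (carrier G - {\<one>\<^bsub>G\<^esub>})"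
    using r finite_group by (intro finprod_insert) auto
  also have "\<dots> \<in> I"
    using r assms(2) by (auto intro!: I.I_r_closed finprod_closed)
  finally show ?thesis .
qed

lemma trace_zero [simp]: "trace \<zero> = \<zero>"
proof -
  have "trace \<zero> = (\<Oplus>g\<in>carrier G. \<zero>)"
    unfolding trace_def by (rule finsum_cong') auto
  then show ?thesis by (simp add: finsum_zero)
qed

lemma trace_add:
  assumes "a \<in> carrier R" "b \<in> carrier R"
  shows "trace (a \<oplus> b) = trace a \<oplus> trace b"
proof -
  have "trace (a \<oplus> b) = (\<Oplus>g\<in>carrier G. \<phi> g a \<oplus> \<phi> g b)"
    unfolding trace_def using assms by (intro finsum_cong') auto
  then show ?thesis unfolding trace_def using assms by (simp add: finsum_addf Pi_def)
qed

lemma trace_invariant_mult: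
  assumes "a \<in> carrier A" "r \<in> carrier R"
  shows "trace (a \<otimes> r) = a \<otimes> trace r"
proof -
  have "trace (a \<otimes> r) = (\<Oplus>g\<in>carrier G. a \<otimes> \<phi> g r)"
    unfolding trace_def using assms invariantD[OF assms(1)] by (intro finsum_cong') auto
  then show ?thesis
    unfolding trace_def using assms invariantD[OF assms(1)] finite_group
    by (simp add: finsum_rdistr Pi_def)
qed

lemma trace_mult_invariant_mult:
  assumes "a \<in> carrier A" "r \<in> carrier R" "s \<in> carrier R"
  shows "trace (s \<otimes> (a \<otimes> r)) = a \<otimes> trace (s \<otimes> r)"
  using trace_invariant_mult[of a "s \<otimes> r"] assms invariantD(1)[OF assms(1)] by (simp add: m_lcomm)

section \<open>Primes with comparable contractions\<close>

lemma translate_if_contraction_subset: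
  assumes P: "ideal P R" and Q: "primeideal Q R" and sub: "P \<inter> carrier A \<subseteq> Q"
  obtains g where "g \<in> carrier G" "\<And>r. r \<in> P \<Longrightarrow> \<phi> g r \<in> Q"
proof -
  interpret P: ideal P R by fact
  interpret Q: primeideal Q R by fact
  \<comment> \<open>The norm of an element of \<open>P\<close> is an invariant in \<open>P\<close>,
    hence lies in \<open>Q\<close>, and then so does one of its factors. Thus finitely many
    translates of \<open>Q\<close> cover \<open>P\<close>, and prime avoidance selects one.\<close>
  have "P \<subseteq> (\<Union>g\<in>carrier G. {r \<in> carrier R. \<phi> g r \<in> Q})"
  proof
    fix r assume r: "r \<in> P"
    then have "r \<in> carrier R" using P.Icarr by blast
    moreover have "norm r \<in> Q" using norm_mem[OF P r] norm_invariant \<open>r \<in> carrier R\<close> sub by blast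
    ultimately show "r \<in> (\<Union>g\<in>carrier G. {r \<in> carrier R. \<phi> g r \<in> Q})"
      using Q.finprod_mem[OF finite_group, of "\<lambda>g. \<phi> g r"] unfolding norm_def by auto
  qed
  then have "\<exists>J\<in>(\<lambda>g. {r \<in> carrier R. \<phi> g r \<in> Q}) ` carrier G. P \<subseteq> J"
    using finite_group translate_primeideal[OF _ Q]
    by (intro prime_avoidance[OF P]) auto
  with that show thesis by blast
qed

lemma translate_comp:
  assumes "g \<in> carrier G" "h \<in> carrier G"
  shows "{r \<in> carrier R. \<phi> g r \<in> {r \<in> carrier R. \<phi> h r \<in> I}} = {r \<in> carrier R. \<phi> (h \<otimes>\<^bsub>G\<^esub> g) r \<in> I}"
  using assms by (auto simp: composition_rule)

text \<open>Some translate of \<open>P\<close> contains \<open>Q\<close>, so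
  \<open>P \<subseteq> Q \<subseteq> t g P\<close>. Applying the \<open>h\<close> for which
  \<open>t h P\<close> is maximal among the finitely many translates of \<open>P\<close> forces
  \<open>t h P = t h Q\<close>, and \<open>h\<close> can be undone.\<close>

lemma primeideal_incomparable:
  assumes P: "primeideal P R" and Q: "primeideal Q R" and "P \<subseteq> Q" "Q \<inter> carrier A \<subseteq> P"
  shows "P = Q"
proof -
  interpret P: primeideal P R by fact
  interpret Q: primeideal Q R by fact
  interpret G: group G by (rule group_G)
  define t where "t g I = {r \<in> carrier R. \<phi> g r \<in> I}" for g I
  obtain g where g: "g \<in> carrier G" "\<And>r. r \<in> Q \<Longrightarrow> \<phi> g r \<in> P"
    using translate_if_contraction_subset[OF Q.is_ideal P assms(4)] by metis
  have QgP: "Q \<subseteq> t g P" unfolding t_def using g Q.Icarr by auto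
  have "finite ((\<lambda>h. t h P) ` carrier G)" "(\<lambda>h. t h P) ` carrier G \<noteq> {}"
    using finite_group by auto
  then obtain h where h: "h \<in> carrier G"
    "\<And>k. k \<in> carrier G \<Longrightarrow> t h P \<subseteq> t k P \<Longrightarrow> t h P = t k P"
    using finite_has_maximal[of "(\<lambda>h. t h P) ` carrier G"] by auto
  have "t h P \<subseteq> t h Q" "t h Q \<subseteq> t h (t g P)" using assms(3) QgP by (auto simp: t_def)
  moreover have "t h (t g P) = t (g \<otimes>\<^bsub>G\<^esub> h) P"
    unfolding t_def using translate_comp[OF h(1) g(1)] .
  ultimately have "t h P = t h Q" using h(2)[of "g \<otimes>\<^bsub>G\<^esub> h"] h(1) g(1) by auto
  moreover have "I = t (inv\<^bsub>G\<^esub> h) (t h I)" if "ideal I R" for I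
    unfolding t_def using h(1) ideal.Icarr[OF that] by auto
  ultimately show ?thesis using P.is_ideal Q.is_ideal by metis
qed

end

section \<open>Dual bases for Galois actions\<close>

text \<open>With \<open>C\<close> an ideal \<open>J\<close> of the invariants this is the module
  \<open>J es\<close> of Nakayama's lemma; with \<open>C\<close> all invariants it is the span of
  \<open>es\<close>. The list recursion suits elimination of one generator at a time.\<close>

fun lincomb :: "('a, 'b) ring_scheme \<Rightarrow> 'a set \<Rightarrow> 'a list \<Rightarrow> 'a set"
  where
    "lincomb R C [] = {\<zero>\<^bsub>R\<^esub>}"
  | "lincomb R C (e # es) = {a \<otimes>\<^bsub>R\<^esub> e \<oplus>\<^bsub>R\<^esub> s | a s. a \<in> C \<and> s \<in> lincomb R C es}"

context finite_ring_action
begin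

lemma lincomb_carrier:
  "ideal J A \<Longrightarrow> set es \<subseteq> carrier R \<Longrightarrow> s \<in> lincomb R J es \<Longrightarrow> s \<in> carrier R"
  by (induct es arbitrary: s) (auto dest!: invariant_idealD(1) invariantD(1))

lemma lincomb_zero:
  assumes "ideal J A" "set es \<subseteq> carrier R"
  shows "\<zero> \<in> lincomb R J es"
  using assms(2)
proof (induct es)
  case (Cons e es)
  then show ?case
    using invariant_idealD(2)[OF assms(1)]
    by (intro lincomb.simps(2)[THEN equalityD2, THEN subsetD] CollectI exI[of _ \<zero>]) auto
qed simp

lemma lincomb_add:
  assumes "ideal J A" "set es \<subseteq> carrier R" "s \<in> lincomb R J es" "t \<in> lincomb R J es"
  shows "s \<oplus> t \<in> lincomb R J es"
  using assms(2-)
proof (induct es arbitrary: s t)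
  case (Cons e es)
  then obtain a s' b t' where *: "a \<in> J" "s' \<in> lincomb R J es" "s = a \<otimes> e \<oplus> s'"
    "b \<in> J" "t' \<in> lincomb R J es" "t = b \<otimes> e \<oplus> t'" by auto
  have c: "a \<in> carrier R" "b \<in> carrier R" "e \<in> carrier R" "s' \<in> carrier R" "t' \<in> carrier R"
    using *(1,2,4,5) Cons.prems(1) lincomb_carrier[OF assms(1), of es]
      invariantD(1)[OF invariant_idealD(1)[OF assms(1)]] by simp_all
  have "s \<oplus> t = (a \<oplus> b) \<otimes> e \<oplus> (s' \<oplus> t')"
    unfolding *(3,6) using c by algebra
  moreover have "a \<oplus> b \<in> J" "s' \<oplus> t' \<in> lincomb R J es"
    using * Cons invariant_idealD(3)[OF assms(1)] by simp_all
  ultimately show ?case by auto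
qed simp

lemma lincomb_mult:
  assumes "ideal J A" "set es \<subseteq> carrier R" "s \<in> lincomb R J es" "r \<in> carrier A"
  shows "r \<otimes> s \<in> lincomb R J es"
  using assms(2,3)
proof (induct es arbitrary: s)
  case (Cons e es)
  then obtain a s' where *: "a \<in> J" "s' \<in> lincomb R J es" "s = a \<otimes> e \<oplus> s'" by auto
  have c: "a \<in> carrier R" "e \<in> carrier R" "s' \<in> carrier R" "r \<in> carrier R"
    using *(1,2) Cons.prems(1) lincomb_carrier[OF assms(1), of es] invariantD(1)[OF assms(4)]
      invariantD(1)[OF invariant_idealD(1)[OF assms(1)]] by simp_all
  have "r \<otimes> s = (r \<otimes> a) \<otimes> e \<oplus> r \<otimes> s'"
    unfolding *(3) using c by algebra
  moreover have "r \<otimes> a \<in> J" "r \<otimes> s' \<in> lincomb R J es"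
    using * Cons assms(4) invariant_idealD(4)[OF assms(1)] by simp_all
  ultimately show ?case by auto
qed (use invariantD(1)[OF assms(4)] in simp)

lemma lincomb_append:
  assumes "ideal J A" "set (es @ fs) \<subseteq> carrier R" "s \<in> lincomb R J es" "t \<in> lincomb R J fs"
  shows "s \<oplus> t \<in> lincomb R J (es @ fs)"
  using assms(2-)
proof (induct es arbitrary: s)
  case Nil
  then show ?case using lincomb_carrier[OF assms(1), of fs t] by simp
next
  case (Cons e es)
  then obtain a s' where *: "a \<in> J" "s' \<in> lincomb R J es" "s = a \<otimes> e \<oplus> s'" by auto
  have c: "a \<in> carrier R" "e \<in> carrier R" "s' \<in> carrier R" "t \<in> carrier R"
    using *(1,2) Cons.prems lincomb_carrier[OF assms(1), of es] lincomb_carrier[OF assms(1), of fs]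
      invariantD(1)[OF invariant_idealD(1)[OF assms(1)]] by simp_all
  then have "s \<oplus> t = a \<otimes> e \<oplus> (s' \<oplus> t)" unfolding *(3) by (simp add: a_assoc)
  moreover have "s' \<oplus> t \<in> lincomb R J (es @ fs)" using * Cons by simp
  ultimately show ?case using * by auto
qed

lemma lincomb_subset:
  assumes J: "ideal J A"
    and N: "\<zero> \<in> N" "\<And>a b. a \<in> N \<Longrightarrow> b \<in> N \<Longrightarrow> a \<oplus> b \<in> N"
      "\<And>r a. r \<in> carrier A \<Longrightarrow> a \<in> N \<Longrightarrow> r \<otimes> a \<in> N"
    and "set es \<subseteq> N"
  shows "lincomb R J es \<subseteq> N"
  using assms(5) by (induct es) (auto intro!: N dest: invariant_idealD(1)[OF J])

lemma lincomb_annihilated: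
  assumes J: "ideal J A" and "set es \<subseteq> carrier R" "v \<in> carrier R"
    and "\<And>e. e \<in> set es \<Longrightarrow> v \<otimes> e = \<zero>" "s \<in> lincomb R J es"
  shows "v \<otimes> s = \<zero>"
  using assms(2,4,5)
proof (induct es arbitrary: s)
  case (Cons e es)
  then obtain a s' where *: "a \<in> J" "s' \<in> lincomb R J es" "s = a \<otimes> e \<oplus> s'" by auto
  have c: "a \<in> carrier R" "e \<in> carrier R" "s' \<in> carrier R"
    using *(1,2) Cons.prems lincomb_carrier[OF J, of es] invariantD(1)[OF invariant_idealD(1)[OF J]]
    by simp_all
  have "v \<otimes> s = a \<otimes> (v \<otimes> e) \<oplus> v \<otimes> s'"
    unfolding *(3) using c assms(3) by algebra
  moreover have "v \<otimes> e = \<zero>" "v \<otimes> s' = \<zero>" using Cons *(2) by simp_all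
  ultimately show ?case using c by simp
qed (use assms(3) in simp)

section \<open>Nakayama's lemma\<close>

lemma one_minus_mult_mem:
  assumes J: "ideal J A" and uv: "u \<in> carrier A" "v \<in> carrier A" "\<one> \<ominus> u \<in> J" "\<one> \<ominus> v \<in> J"
  shows "\<one> \<ominus> u \<otimes> v \<in> J"
proof -
  have "\<one> \<ominus> u \<otimes> v = (\<one> \<ominus> u) \<oplus> u \<otimes> (\<one> \<ominus> v)"
    using invariantD(1)[OF uv(1)] invariantD(1)[OF uv(2)] by algebra
  then show ?thesis using invariant_idealD[OF J] uv by metis
qed

text \<open>Nakayama's lemma, with elimination of the generators one at a time in place of determinants;
  the unit-like element \<open>u\<close> is what makes the induction go through.\<close>

lemma nakayama_elimination:
  assumes J: "ideal J A" and "set es \<subseteq> carrier R" "u \<in> carrier A" "\<one> \<ominus> u \<in> J"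
    and "\<And>e. e \<in> set es \<Longrightarrow> u \<otimes> e \<in> lincomb R J es"
  shows "\<exists>v\<in>carrier A. \<one> \<ominus> v \<in> J \<and> (\<forall>e\<in>set es. v \<otimes> e = \<zero>)"
  using assms(2-)
proof (induct es arbitrary: u)
  case Nil
  then show ?case by auto
next
  case (Cons e es)
  have uR: "u \<in> carrier R" and eR: "e \<in> carrier R" and esR: "set es \<subseteq> carrier R"
    using Cons.prems invariantD(1) by auto
  obtain a s where as: "a \<in> J" "s \<in> lincomb R J es" "u \<otimes> e = a \<otimes> e \<oplus> s"
    using Cons.prems(4)[of e] by auto
  have aA: "a \<in> carrier A" using invariant_idealD(1)[OF J] as by blast
  have aR: "a \<in> carrier R" and sR: "s \<in> carrier R"
    using aA invariantD(1) lincomb_carrier[OF J esR as(2)] by auto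
  \<comment> \<open>Solving the relation for \<open>e\<close> gives \<open>(u - a) e = s\<close>,
    and \<open>u - a\<close> is still congruent to one modulo \<open>J\<close>.\<close>
  define u' where "u' = u \<ominus> a"
  have u'A: "u' \<in> carrier A" unfolding u'_def using Cons.prems aA invariant_closed by simp
  then have u'R: "u' \<in> carrier R" using invariantD(1) by blast
  have "u' \<otimes> e = u \<otimes> e \<ominus> a \<otimes> e" unfolding u'_def using uR aR eR by algebra
  also have "\<dots> = s" unfolding as(3) using aR eR sR by algebra
  finally have u'e: "u' \<otimes> e = s" .
  have "\<one> \<ominus> u' = (\<one> \<ominus> u) \<oplus> a" unfolding u'_def using uR aR by algebra
  then have u'J: "\<one> \<ominus> u' \<in> J" using as(1) Cons.prems(3) invariant_idealD(3)[OF J] by metis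
  \<comment> \<open>Multiplying the relation for \<open>f\<close> by \<open>u'\<close> allows
    \<open>u' e\<close> to be replaced by \<open>s\<close>, which removes \<open>e\<close> from the
    right-hand side.\<close>
  have "(u' \<otimes> u) \<otimes> f \<in> lincomb R J es" if f: "f \<in> set es" for f
  proof -
    have fR: "f \<in> carrier R" using f esR by blast
    obtain b t where bt: "b \<in> J" "t \<in> lincomb R J es" "u \<otimes> f = b \<otimes> e \<oplus> t"
      using Cons.prems(4)[of f] f by auto
    have bA: "b \<in> carrier A" using invariant_idealD(1)[OF J] bt by blast
    have bR: "b \<in> carrier R" and tR: "t \<in> carrier R"
      using bA invariantD(1) lincomb_carrier[OF J esR bt(2)] by auto
    have "(u' \<otimes> u) \<otimes> f = u' \<otimes> (b \<otimes> e \<oplus> t)"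
      using u'R uR fR by (simp add: m_assoc bt(3))
    also have "\<dots> = b \<otimes> (u' \<otimes> e) \<oplus> u' \<otimes> t" using u'R bR eR tR by algebra
    also have "\<dots> \<in> lincomb R J es"
      unfolding u'e using as(2) bt(2) bA u'A lincomb_add[OF J esR] lincomb_mult[OF J esR] by blast
    finally show ?thesis .
  qed
  moreover have "u' \<otimes> u \<in> carrier A" using u'A Cons.prems invariant_closed by simp
  moreover have "\<one> \<ominus> u' \<otimes> u \<in> J" using one_minus_mult_mem[OF J u'A] Cons.prems u'J by simp
  ultimately obtain v where v: "v \<in> carrier A" "\<one> \<ominus> v \<in> J" "\<And>f. f \<in> set es \<Longrightarrow> v \<otimes> f = \<zero>"
    using Cons.hyps[OF esR] by blast
  have vR: "v \<in> carrier R" using v invariantD(1) by blast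
  \<comment> \<open>The eliminated generator is also killed, since \<open>u' e\<close> is a
    combination of \<open>es\<close>.\<close>
  have "v \<otimes> u' \<otimes> e = v \<otimes> s" using vR u'R eR by (simp add: m_assoc u'e)
  also have "\<dots> = \<zero>" using lincomb_annihilated[OF J esR vR v(3) as(2)] .
  finally have "v \<otimes> u' \<otimes> e = \<zero>" .
  moreover have "v \<otimes> u' \<otimes> f = \<zero>" if "f \<in> set es" for f
  proof -
    have fR: "f \<in> carrier R" using that esR by blast
    have "v \<otimes> u' \<otimes> f = u' \<otimes> (v \<otimes> f)" using vR u'R fR by algebra
    then show ?thesis using v(3)[OF that] u'R by simp
  qed
  ultimately show ?case
    using one_minus_mult_mem[OF J v(1) u'A v(2) u'J] v(1) u'A invariant_closed(4)
    by (intro bexI[of _ "v \<otimes> u'"]) auto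
qed

text \<open>A list of pairs stands for an element of the tensor square of \<open>R\<close> over the
  invariants. Its pair sum is the image among the functions from the group to \<open>R\<close>,
  where the tensor of \<open>x\<close> and \<open>y\<close> becomes
  \<open>g \<mapsto> x g(y)\<close>.\<close>

fun pair_sum :: "('c \<times> 'c) list \<Rightarrow> 'a \<Rightarrow> 'c"
  where
    "pair_sum [] g = \<zero>"
  | "pair_sum ((x, y) # ps) g = x \<otimes> \<phi> g y \<oplus> pair_sum ps g"

text \<open>The candidate dual basis expansion of \<open>r\<close>: the first components are the
  basis, the maps \<open>r \<mapsto> trace (y r)\<close> the coordinates.\<close>

fun dual_sum :: "('c \<times> 'c) list \<Rightarrow> 'c \<Rightarrow> 'c"
  where
    "dual_sum [] r = \<zero>"
  | "dual_sum ((x, y) # ps) r = x \<otimes> trace (y \<otimes> r) \<oplus> dual_sum ps r"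

abbreviation pairs where "pairs ps \<equiv> set ps \<subseteq> carrier R \<times> carrier R"

lemma pair_sum_closed [simp]: "pairs ps \<Longrightarrow> g \<in> carrier G \<Longrightarrow> pair_sum ps g \<in> carrier R"
  by (induct ps g rule: pair_sum.induct) auto

lemma pair_sum_append:
  "pairs (ps @ qs) \<Longrightarrow> g \<in> carrier G \<Longrightarrow> pair_sum (ps @ qs) g = pair_sum ps g \<oplus> pair_sum qs g"
  by (induct ps g rule: pair_sum.induct) (auto simp: a_assoc)

lemma pair_sum_map:
  "pairs ps \<Longrightarrow> x \<in> carrier R \<Longrightarrow> y \<in> carrier R \<Longrightarrow> g \<in> carrier G \<Longrightarrow>
    pair_sum (map (\<lambda>(x', y'). (x \<otimes> x', y \<otimes> y')) ps) g = (x \<otimes> \<phi> g y) \<otimes> pair_sum ps g"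
  by (induct ps g rule: pair_sum.induct) (auto simp: r_distr m_ac)

text \<open>Pairs multiply componentwise, as in the tensor square, because each
  \<open>\<phi> g\<close> is multiplicative. This closes the functions given by pair sums under
  pointwise products.\<close>

lemma pair_sum_mult:
  assumes qs: "pairs qs"
  shows "pairs ps \<Longrightarrow> \<exists>rs. pairs rs \<and> (\<forall>g\<in>carrier G. pair_sum rs g = pair_sum ps g \<otimes> pair_sum qs g)"
proof (induct ps)
  case Nil
  show ?case by (rule exI[of _ "[]"]) (use qs in simp)
next
  case (Cons p ps)
  obtain x y where p: "p = (x, y)" by force
  obtain rs where rs: "pairs rs" "\<And>g. g \<in> carrier G \<Longrightarrow> pair_sum rs g = pair_sum ps g \<otimes> pair_sum qs g"
    using Cons by auto
  let ?m = "map (\<lambda>(x', y'). (x \<otimes> x', y \<otimes> y')) qs"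
  have "pairs (?m @ rs)" using Cons.prems p qs rs by auto
  moreover have "pair_sum (?m @ rs) g = pair_sum (p # ps) g \<otimes> pair_sum qs g"
    if "g \<in> carrier G" for g
    using that Cons.prems qs rs(2) p pair_sum_append[OF \<open>pairs (?m @ rs)\<close>]
    by (simp add: pair_sum_map l_distr)
  ultimately show ?case by blast
qed

text \<open>Expanding the traces and interchanging the two sums shows that only the pair sums
  matter; if they are one at the identity and zero elsewhere, just \<open>r\<close> is left.\<close>

lemma dual_sum_eq:
  assumes r: "r \<in> carrier R"
  shows "pairs ps \<Longrightarrow> dual_sum ps r = (\<Oplus>g\<in>carrier G. pair_sum ps g \<otimes> \<phi> g r)"
proof (induct ps)
  case Nil
  have "(\<Oplus>g\<in>carrier G. pair_sum [] g \<otimes> \<phi> g r) = (\<Oplus>g\<in>carrier G. \<zero>)"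
    using r by (intro finsum_cong') auto
  then show ?case by (simp add: finsum_zero)
next
  case (Cons p ps)
  obtain x y where p: "p = (x, y)" by force
  have xy: "x \<in> carrier R" "y \<in> carrier R" "pairs ps" using Cons.prems p by auto
  have "(\<Oplus>g\<in>carrier G. pair_sum (p # ps) g \<otimes> \<phi> g r)
      = (\<Oplus>g\<in>carrier G. x \<otimes> \<phi> g (y \<otimes> r) \<oplus> pair_sum ps g \<otimes> \<phi> g r)"
    using xy r by (intro finsum_cong') (auto simp: p l_distr m_assoc)
  also have "\<dots> = (\<Oplus>g\<in>carrier G. x \<otimes> \<phi> g (y \<otimes> r)) \<oplus> (\<Oplus>g\<in>carrier G. pair_sum ps g \<otimes> \<phi> g r)"
    using xy r by (intro finsum_addf) auto
  also have "(\<Oplus>g\<in>carrier G. x \<otimes> \<phi> g (y \<otimes> r)) = x \<otimes> trace (y \<otimes> r)"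
    unfolding trace_def using xy r finite_group by (intro finsum_rdistr[symmetric]) auto
  finally show ?case using Cons p by simp
qed

lemma dual_sum_mem:
  assumes I: "ideal I R"
  shows "pairs ps \<Longrightarrow> \<forall>y\<in>snd ` set ps. trace (y \<otimes> r) \<in> I \<Longrightarrow> dual_sum ps r \<in> I"
proof (induct ps)
  case Nil
  then show ?case using additive_subgroup.zero_closed[OF ideal.axioms(1)[OF I]] by simp
next
  case (Cons p ps)
  obtain x y where "p = (x, y)" by force
  then show ?case
    using Cons ideal.add_mem[OF I] ideal.I_l_closed[OF I] by simp
qed

lemma dual_sum_lincomb:
  assumes J: "ideal J A"
  shows "pairs ps \<Longrightarrow> \<forall>y\<in>snd ` set ps. trace (y \<otimes> r) \<in> J \<Longrightarrow>
    dual_sum ps r \<in> lincomb R J (map fst ps)"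
proof (induct ps)
  case (Cons p ps)
  obtain x y where p: "p = (x, y)" by force
  then have t: "trace (y \<otimes> r) \<in> J" using Cons.prems by simp
  then have "trace (y \<otimes> r) \<in> carrier R" using invariant_idealD(1)[OF J] invariantD(1) by blast
  then have "dual_sum (p # ps) r = trace (y \<otimes> r) \<otimes> x \<oplus> dual_sum ps r"
    using Cons.prems p by (simp add: m_comm)
  moreover have "dual_sum ps r \<in> lincomb R J (map fst ps)" using Cons by simp
  ultimately show ?case using t p by auto
qed simp

lemma pair_sum_annihilated:
  assumes "pairs ps" "g \<in> carrier G" "v \<in> carrier R" "\<forall>e\<in>fst ` set ps. v \<otimes> e = \<zero>"
  shows "v \<otimes> pair_sum ps g = \<zero>"
  using assms
proof (induct ps)
  case (Cons p ps)
  obtain x y where p: "p = (x, y)" by force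
  have "v \<otimes> pair_sum (p # ps) g = (v \<otimes> x) \<otimes> \<phi> g y \<oplus> v \<otimes> pair_sum ps g"
    using Cons.prems p by (simp add: r_distr m_assoc[symmetric])
  also have "\<dots> = \<zero>" using Cons p by simp
  finally show ?case .
qed simp

end

section \<open>Existence of the dual basis and of an element of trace one\<close>

locale galois_ring_action = finite_ring_action +
  assumes galois: "galois_action G R \<phi>"
begin

text \<open>The values at the identity of pair sums vanishing at \<open>g\<close> form an ideal
  \<open>J\<close> that contains every \<open>g(r) - r\<close>. A maximal ideal above
  \<open>J\<close> would therefore have \<open>g\<close> in its inertia group, so \<open>J\<close>
  is the whole ring.\<close>

lemma separating_pairs:
  assumes g: "g \<in> carrier G" "g \<noteq> \<one>\<^bsub>G\<^esub>"
  shows "\<exists>ps. pairs ps \<and> pair_sum ps \<one>\<^bsub>G\<^esub> = \<one> \<and> pair_sum ps g = \<zero>"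
proof -
  interpret G: group G by (rule group_G)
  define J where "J = {a \<in> carrier R. \<exists>ps. pairs ps \<and> pair_sum ps \<one>\<^bsub>G\<^esub> = a \<and> pair_sum ps g = \<zero>}"
  have "ideal J R"
  proof (rule ideal_if_closed)
    show "J \<subseteq> carrier R" by (auto simp: J_def)
    show "\<zero> \<in> J" unfolding J_def by (auto intro!: exI[of _ "[]"])
  next
    fix a b assume ab: "a \<in> J" "b \<in> J"
    then obtain ps qs where "pairs ps" "pair_sum ps \<one>\<^bsub>G\<^esub> = a" "pair_sum ps g = \<zero>"
      "pairs qs" "pair_sum qs \<one>\<^bsub>G\<^esub> = b" "pair_sum qs g = \<zero>" by (auto simp: J_def)
    then show "a \<oplus> b \<in> J" using ab g unfolding J_def
      by (auto intro!: exI[of _ "ps @ qs"] simp: pair_sum_append)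
  next
    fix a t assume at: "a \<in> J" "t \<in> carrier R"
    then obtain ps where ps: "pairs ps" "pair_sum ps \<one>\<^bsub>G\<^esub> = a" "pair_sum ps g = \<zero>"
      by (auto simp: J_def)
    let ?m = "map (\<lambda>(x', y'). (t \<otimes> x', \<one> \<otimes> y')) ps"
    have "pairs ?m" "pair_sum ?m \<one>\<^bsub>G\<^esub> = t \<otimes> a" "pair_sum ?m g = \<zero>"
      using ps at g pair_sum_map[OF ps(1) at(2) one_closed] by auto
    then show "t \<otimes> a \<in> J" using at unfolding J_def by blast
  qed
  moreover have "J = carrier R"
  proof (rule ccontr)
    assume "J \<noteq> carrier R"
    then obtain M where M: "maximalideal M R" "J \<subseteq> M"
      using exists_maximalideal \<open>ideal J R\<close> by metis
    have "\<phi> g r \<ominus> r \<in> J" if r: "r \<in> carrier R" for r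
    proof -
      \<comment> \<open>The list encodes the tensor of \<open>\<phi> g r\<close> and one minus that
        of one and \<open>r\<close>; its value at \<open>h\<close> vanishes for
        \<open>h = g\<close>.\<close>
      have e: "pair_sum [(\<phi> g r, \<one>), (\<ominus> \<one>, r)] h = \<phi> g r \<ominus> \<phi> h r" if "h \<in> carrier G" for h
        using that r g by (simp add: l_minus minus_eq)
      have "pairs [(\<phi> g r, \<one>), (\<ominus> \<one>, r)]" using r g by simp
      moreover have "pair_sum [(\<phi> g r, \<one>), (\<ominus> \<one>, r)] \<one>\<^bsub>G\<^esub> = \<phi> g r \<ominus> r"
        using e[of "\<one>\<^bsub>G\<^esub>"] r by simp
      moreover have "pair_sum [(\<phi> g r, \<one>), (\<ominus> \<one>, r)] g = \<zero>"
        using e[of g] r g by (simp add: r_neg minus_eq)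
      ultimately have "\<exists>ps. pairs ps \<and> pair_sum ps \<one>\<^bsub>G\<^esub> = \<phi> g r \<ominus> r \<and> pair_sum ps g = \<zero>"
        by (intro exI[of _ "[(\<phi> g r, \<one>), (\<ominus> \<one>, r)]"] conjI)
      then show ?thesis using r g unfolding J_def by simp
    qed
    then have "g \<in> inertia_group G R \<phi> M" using M(2) g by (auto simp: inertia_group_def)
    then show False using galois M(1) g unfolding galois_action_def by auto
  qed
  ultimately show ?thesis unfolding J_def by blast
qed

text \<open>Multiplying, over all \<open>s\<close> other than the identity, pair sums that are one
  at the identity and zero at \<open>s\<close> produces the delta function.\<close>

lemma exists_dual_pairs:
  "\<exists>ps. pairs ps \<and> (\<forall>g\<in>carrier G. pair_sum ps g = (if g = \<one>\<^bsub>G\<^esub> then \<one> else \<zero>))"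
proof -
  interpret G: group G by (rule group_G)
  have "\<exists>ps. pairs ps \<and> pair_sum ps \<one>\<^bsub>G\<^esub> = \<one> \<and> (\<forall>g\<in>S. pair_sum ps g = \<zero>)"
    if "finite S" "S \<subseteq> carrier G - {\<one>\<^bsub>G\<^esub>}" for S
    using that
  proof (induct S rule: finite_induct)
    case empty
    show ?case by (rule exI[of _ "[(\<one>, \<one>)]"]) simp
  next
    case (insert s S)
    obtain ps where ps: "pairs ps" "pair_sum ps \<one>\<^bsub>G\<^esub> = \<one>" "\<And>g. g \<in> S \<Longrightarrow> pair_sum ps g = \<zero>"
      using insert by auto
    obtain qs where qs: "pairs qs" "pair_sum qs \<one>\<^bsub>G\<^esub> = \<one>" "pair_sum qs s = \<zero>"
      using separating_pairs[of s] insert by auto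
    obtain rs where rs: "pairs rs" "\<And>g. g \<in> carrier G \<Longrightarrow> pair_sum rs g = pair_sum ps g \<otimes> pair_sum qs g"
      using pair_sum_mult[OF qs(1) ps(1)] by auto
    have "pair_sum rs g = \<zero>" if "g \<in> insert s S" for g
    proof -
      have "g \<in> carrier G" using that insert.prems by auto
      then show ?thesis using that rs(2)[of g] ps(1,3) qs(1,3) by auto
    qed
    moreover have "pair_sum rs \<one>\<^bsub>G\<^esub> = \<one>" using rs(2)[of "\<one>\<^bsub>G\<^esub>"] ps(2) qs(2) by simp
    ultimately show ?case using rs(1) by blast
  qed
  from this[of "carrier G - {\<one>\<^bsub>G\<^esub>}"] finite_group show ?thesis by auto
qed

definition dual_pairs :: "('c \<times> 'c) list" where
  "dual_pairs = (SOME ps. pairs ps \<and>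
    (\<forall>g\<in>carrier G. pair_sum ps g = (if g = \<one>\<^bsub>G\<^esub> then \<one> else \<zero>)))"

lemma dual_pairs:
  shows "pairs dual_pairs"
    and "g \<in> carrier G \<Longrightarrow> pair_sum dual_pairs g = (if g = \<one>\<^bsub>G\<^esub> then \<one> else \<zero>)"
  using someI_ex[OF exists_dual_pairs] unfolding dual_pairs_def by blast+

lemma dual_sum_dual_pairs:
  assumes r: "r \<in> carrier R"
  shows "dual_sum dual_pairs r = r"
proof -
  interpret G: group G by (rule group_G)
  have "dual_sum dual_pairs r = (\<Oplus>g\<in>carrier G. if \<one>\<^bsub>G\<^esub> = g then \<phi> g r else \<zero>)"
    unfolding dual_sum_eq[OF r dual_pairs(1)]
    using r dual_pairs(2) by (intro finsum_cong') auto
  also have "\<dots> = \<phi> \<one>\<^bsub>G\<^esub> r"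
    using finite_group r by (intro finsum_singleton) auto
  finally show ?thesis using r by simp
qed

lemma mem_if_trace_mem:
  assumes "ideal I R" "r \<in> carrier R" "\<forall>y\<in>snd ` set dual_pairs. trace (y \<otimes> r) \<in> I"
  shows "r \<in> I"
  using dual_sum_mem[OF assms(1) dual_pairs(1) assms(3)] dual_sum_dual_pairs[OF assms(2)] by simp

text \<open>The traces form an ideal \<open>J\<close> of the invariants, and the dual basis
  expansion has its coefficients in \<open>J\<close>. Nakayama's lemma gives \<open>v\<close>
  congruent to one modulo \<open>J\<close> that kills the first components, hence also the pair sum
  at the identity, which is one. So \<open>v\<close> is zero and one lies in
  \<open>J\<close>.\<close>

lemma exists_trace_one: "\<exists>c\<in>carrier R. trace c = \<one>"
proof -
  interpret G: group G by (rule group_G)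
  define J where "J = trace ` carrier R"
  have J: "ideal J A"
  proof (rule invariant_ideal_if_closed)
    show "J \<subseteq> carrier A" using trace_invariant by (auto simp: J_def)
    show "\<zero> \<in> J" unfolding J_def using trace_zero by (metis imageI zero_closed)
  next
    fix a b assume "a \<in> J" "b \<in> J"
    then show "a \<oplus> b \<in> J"
      unfolding J_def by (auto simp: trace_add[symmetric])
  next
    fix a r assume "a \<in> J" "r \<in> carrier A"
    then show "r \<otimes> a \<in> J"
      unfolding J_def using invariantD(1) by (auto simp: trace_invariant_mult[symmetric])
  qed
  have es: "set (map fst dual_pairs) \<subseteq> carrier R" using dual_pairs(1) by auto
  have "\<one> \<otimes> e \<in> lincomb R J (map fst dual_pairs)" if "e \<in> set (map fst dual_pairs)" for e
  proof -
    have e: "e \<in> carrier R" using that es by blast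
    then have "\<forall>y\<in>snd ` set dual_pairs. trace (y \<otimes> e) \<in> J"
      using dual_pairs(1) by (auto simp: J_def)
    then show ?thesis
      using dual_sum_lincomb[OF J dual_pairs(1)] dual_sum_dual_pairs[OF e] e by fastforce
  qed
  moreover have "\<one> \<ominus> \<one> \<in> J" using invariant_idealD(2)[OF J] by (simp add: r_neg minus_eq)
  ultimately obtain v where v: "v \<in> carrier A" "\<one> \<ominus> v \<in> J"
    "\<And>e. e \<in> set (map fst dual_pairs) \<Longrightarrow> v \<otimes> e = \<zero>"
    using nakayama_elimination[OF J es invariant_closed(2)] by blast
  have "v \<otimes> pair_sum dual_pairs \<one>\<^bsub>G\<^esub> = \<zero>"
    using v invariantD(1) by (intro pair_sum_annihilated[OF dual_pairs(1)]) auto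
  then have "v = \<zero>" using dual_pairs(2)[of "\<one>\<^bsub>G\<^esub>"] v(1) invariantD(1) by simp
  then show ?thesis using v(2) by (auto simp: J_def minus_eq)
qed

end

section \<open>Descent of chains and regular sequences to the invariants\<close>

context finite_ring_action
begin

lemma lincomb_subset_Idl:
  assumes "set es \<subseteq> carrier R"
  shows "lincomb R (carrier A) es \<subseteq> Idl (set es)"
proof -
  interpret A: cring A by (rule invariant_ring_cring)
  interpret I: ideal "Idl (set es)" R using genideal_ideal[OF assms] .
  show ?thesis
    by (rule lincomb_subset[OF A.oneideal])
      (use genideal_self[OF assms] in \<open>auto intro: I.add_mem I.I_l_closed invariantD(1)\<close>)
qed

lemma Idl_invariant_subset:
  assumes "S \<subseteq> carrier A"
  shows "Idl\<^bsub>A\<^esub> S \<subseteq> Idl S"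
proof -
  interpret A: cring A by (rule invariant_ring_cring)
  have S: "S \<subseteq> carrier R" using assms invariantD(1) by blast
  have "Idl\<^bsub>A\<^esub> S \<subseteq> Idl S \<inter> carrier A"
    by (rule A.genideal_minimal[OF contraction_ideal[OF genideal_ideal[OF S]]])
      (use genideal_self[OF S] assms in blast)
  then show ?thesis by blast
qed

text \<open>The generators are fixed by the group, so every translate of the ideal contains
  them.\<close>

lemma Idl_stable:
  assumes "S \<subseteq> carrier A" "g \<in> carrier G" "r \<in> carrier R"
  shows "\<phi> g r \<in> Idl S \<longleftrightarrow> r \<in> Idl S"
proof -
  interpret G: group G by (rule group_G)
  have S: "S \<subseteq> carrier R" using assms invariantD(1) by blast
  have *: "\<phi> h s \<in> Idl S" if "h \<in> carrier G" "s \<in> Idl S" for h s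
  proof -
    have "S \<subseteq> {r \<in> carrier R. \<phi> h r \<in> Idl S}"
    proof
      fix a assume "a \<in> S"
      then have "a \<in> carrier A" "a \<in> Idl S" using assms(1) genideal_self[OF S] by auto
      then show "a \<in> {r \<in> carrier R. \<phi> h r \<in> Idl S}" using that(1) by (simp add: invariantD)
    qed
    then have "Idl S \<subseteq> {r \<in> carrier R. \<phi> h r \<in> Idl S}"
      by (rule genideal_minimal[OF translate_ideal[OF that(1) genideal_ideal[OF S]]])
    with that(2) show ?thesis by blast
  qed
  show ?thesis
    using *[of "inv\<^bsub>G\<^esub> g" "\<phi> g r"] *[of g r] assms(2,3) by auto
qed

text \<open>Stability of the ideal transfers the property from \<open>z\<close> to all its
  conjugates, and the norm is their product.\<close>

lemma nonzerodivisor_mod_norm: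
  assumes S: "S \<subseteq> carrier A" and z: "z \<in> carrier R" "nonzerodivisor_mod R (Idl S) z"
  shows "nonzerodivisor_mod R (Idl S) (norm z)"
  unfolding norm_def
proof (rule nonzerodivisor_mod_finprod[OF finite_group])
  interpret G: group G by (rule group_G)
  fix g assume g: "g \<in> carrier G"
  show "nonzerodivisor_mod R (Idl S) (\<phi> g z)"
    unfolding nonzerodivisor_mod_def
  proof (intro ballI impI)
    fix r assume r: "r \<in> carrier R" "\<phi> g z \<otimes> r \<in> Idl S"
    let ?r = "\<phi> (inv\<^bsub>G\<^esub> g) r"
    have "\<phi> g (z \<otimes> ?r) = \<phi> g z \<otimes> r" using z r g by simp
    then have "z \<otimes> ?r \<in> Idl S" using Idl_stable[OF S g, of "z \<otimes> ?r"] z r g by simp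
    then have "?r \<in> Idl S" using nonzerodivisor_modD[OF z(2), of ?r] r g by simp
    then show "r \<in> Idl S" using Idl_stable[OF S, of "inv\<^bsub>G\<^esub> g" r] g r by simp
  qed
qed (use z in auto)

end

section \<open>Extended ideals and flatness\<close>

context galois_ring_action
begin

text \<open>The elements satisfying the trace condition form an ideal of \<open>R\<close>, which
  contains \<open>S\<close> by linearity of the trace over the invariants. Conversely, the dual
  basis expansion rebuilds \<open>r\<close> from its traces. Questions about the extended ideal thus
  become questions inside the invariant ring.\<close>

lemma mem_Idl_iff_trace:
  assumes S: "S \<subseteq> carrier A" and r: "r \<in> carrier R"
  shows "r \<in> Idl S \<longleftrightarrow> (\<forall>s\<in>carrier R. trace (s \<otimes> r) \<in> Idl\<^bsub>A\<^esub> S)"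
proof
  interpret A: cring A by (rule invariant_ring_cring)
  have SR: "S \<subseteq> carrier R" using S invariantD(1) by blast
  note IA = A.genideal_ideal[OF S]
  show "\<forall>s\<in>carrier R. trace (s \<otimes> r) \<in> Idl\<^bsub>A\<^esub> S" if "r \<in> Idl S"
  proof -
    have "ideal {r \<in> carrier R. \<forall>s\<in>carrier R. trace (s \<otimes> r) \<in> Idl\<^bsub>A\<^esub> S} R"
    proof (rule ideal_if_closed)
      fix a t assume a: "a \<in> {r \<in> carrier R. \<forall>s\<in>carrier R. trace (s \<otimes> r) \<in> Idl\<^bsub>A\<^esub> S}"
        and t: "t \<in> carrier R"
      then have "trace (s \<otimes> (t \<otimes> a)) \<in> Idl\<^bsub>A\<^esub> S" if "s \<in> carrier R" for s
        using that by (simp add: m_assoc[symmetric])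
      then show "t \<otimes> a \<in> {r \<in> carrier R. \<forall>s\<in>carrier R. trace (s \<otimes> r) \<in> Idl\<^bsub>A\<^esub> S}"
        using a t by simp
    qed (auto simp: r_distr trace_add invariant_idealD[OF IA])
    moreover have "S \<subseteq> {r \<in> carrier R. \<forall>s\<in>carrier R. trace (s \<otimes> r) \<in> Idl\<^bsub>A\<^esub> S}"
    proof
      fix a assume a: "a \<in> S"
      then have aA: "a \<in> carrier A" using S by blast
      have "trace (s \<otimes> a) \<in> Idl\<^bsub>A\<^esub> S" if s: "s \<in> carrier R" for s
      proof -
        have "trace (s \<otimes> a) = trace s \<otimes> a"
          using trace_invariant_mult[OF aA s] invariantD(1)[OF aA] s by (simp add: m_comm)
        moreover have "a \<in> Idl\<^bsub>A\<^esub> S" using a A.genideal_self[OF S] by blast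
        ultimately show ?thesis
          using invariant_idealD(4)[OF IA] trace_invariant[OF s] by simp
      qed
      then show "a \<in> {r \<in> carrier R. \<forall>s\<in>carrier R. trace (s \<otimes> r) \<in> Idl\<^bsub>A\<^esub> S}"
        using invariantD(1)[OF aA] by simp
    qed
    ultimately show ?thesis using genideal_minimal that by blast
  qed
  assume *: "\<forall>s\<in>carrier R. trace (s \<otimes> r) \<in> Idl\<^bsub>A\<^esub> S"
  have "snd ` set dual_pairs \<subseteq> carrier R" using dual_pairs(1) by auto
  then have "\<forall>y\<in>snd ` set dual_pairs. trace (y \<otimes> r) \<in> Idl S"
    using * Idl_invariant_subset[OF S] by blast
  then show "r \<in> Idl S" using mem_if_trace_mem[OF genideal_ideal[OF SR] r] by blast
qed

text \<open>An element \<open>c\<close> of trace one recovers \<open>a\<close> as the trace of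
  \<open>c a\<close>, so extending an ideal and contracting it again adds nothing.\<close>

lemma mem_Idl_invariant_iff:
  assumes S: "S \<subseteq> carrier A" and a: "a \<in> carrier A"
  shows "a \<in> Idl\<^bsub>A\<^esub> S \<longleftrightarrow> a \<in> Idl S"
proof
  show "a \<in> Idl S" if "a \<in> Idl\<^bsub>A\<^esub> S" using that Idl_invariant_subset[OF S] by blast
next
  assume "a \<in> Idl S"
  obtain c where c: "c \<in> carrier R" "trace c = \<one>" using exists_trace_one by blast
  have "trace (c \<otimes> a) = a"
    using trace_invariant_mult[OF a c(1)] invariantD(1)[OF a] c by (simp add: m_comm)
  moreover have "trace (c \<otimes> a) \<in> Idl\<^bsub>A\<^esub> S"
    using mem_Idl_iff_trace[OF S invariantD(1)[OF a]] \<open>a \<in> Idl S\<close> c by blast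
  ultimately show "a \<in> Idl\<^bsub>A\<^esub> S" by simp
qed

lemma Idl_invariant_ideal_Int:
  assumes "ideal I A"
  shows "Idl I \<inter> carrier A = I"
proof -
  interpret A: cring A by (rule invariant_ring_cring)
  have I: "I \<subseteq> carrier A" using ideal.Icarr[OF assms] by blast
  have "Idl\<^bsub>A\<^esub> I = I" using A.genideal_minimal[OF assms] A.genideal_self[OF I] by blast
  then show ?thesis using mem_Idl_invariant_iff[OF I] I by blast
qed

text \<open>The form of flatness that is used: the invariant \<open>x\<close> can be taken out of
  every trace, so it is cancelled in the invariant ring and the trace criterion carries the result
  back to \<open>R\<close>.\<close>

lemma nonzerodivisor_mod_iff:
  assumes S: "S \<subseteq> carrier A" and x: "x \<in> carrier A"
  shows "nonzerodivisor_mod A (Idl\<^bsub>A\<^esub> S) x \<longleftrightarrow> nonzerodivisor_mod R (Idl S) x"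
proof
  assume A: "nonzerodivisor_mod A (Idl\<^bsub>A\<^esub> S) x"
  show "nonzerodivisor_mod R (Idl S) x"
    unfolding nonzerodivisor_mod_def
  proof (intro ballI impI)
    fix r assume r: "r \<in> carrier R" "x \<otimes> r \<in> Idl S"
    have xr: "x \<otimes> r \<in> carrier R" using x r invariantD(1) by blast
    have "trace (s \<otimes> r) \<in> Idl\<^bsub>A\<^esub> S" if s: "s \<in> carrier R" for s
    proof -
      have "x \<otimes> trace (s \<otimes> r) \<in> Idl\<^bsub>A\<^esub> S"
        using r s mem_Idl_iff_trace[OF S xr] trace_mult_invariant_mult[OF x r(1) s] by auto
      then show ?thesis
        using nonzerodivisor_modD[OF A] trace_invariant[of "s \<otimes> r"] r s by simp
    qed
    then show "r \<in> Idl S" using mem_Idl_iff_trace[OF S r(1)] by blast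
  qed
next
  assume R: "nonzerodivisor_mod R (Idl S) x"
  show "nonzerodivisor_mod A (Idl\<^bsub>A\<^esub> S) x"
    unfolding nonzerodivisor_mod_def
  proof (intro ballI impI)
    fix a assume a: "a \<in> carrier A" "x \<otimes>\<^bsub>A\<^esub> a \<in> Idl\<^bsub>A\<^esub> S"
    then have "x \<otimes> a \<in> Idl S" using Idl_invariant_subset[OF S] by auto
    then show "a \<in> Idl\<^bsub>A\<^esub> S"
      using nonzerodivisor_modD[OF R invariantD(1)[OF a(1)]] mem_Idl_invariant_iff[OF S a(1)] by blast
  qed
qed

lemma regular_over_iff:
  "S \<subseteq> carrier A \<Longrightarrow> set xs \<subseteq> carrier A \<Longrightarrow> regular_over A S xs \<longleftrightarrow> regular_over R S xs"
  by (induct xs arbitrary: S) (auto simp: nonzerodivisor_mod_iff)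

section \<open>Noetherianity in both directions\<close>

lemma noetherian_invariant_ring:
  assumes "noetherian_ring R"
  shows "noetherian_ring A"
proof (rule ring.noetherian_ringI)
  interpret A: cring A by (rule invariant_ring_cring)
  interpret N: noetherian_ring R by fact
  show "ring A" by (rule A.ring_axioms)
  fix I assume I: "ideal I A"
  have IA: "I \<subseteq> carrier A" using ideal.Icarr[OF I] by blast
  then have "I \<subseteq> carrier R" using invariantD(1) by blast
  \<comment> \<open>The generators of the extended ideal are taken from \<open>I\<close>;
    contracting back shows that they generate \<open>I\<close> already over the invariants.\<close>
  then obtain F where F: "finite F" "F \<subseteq> I" "Idl F = Idl I" using N.Idl_finite_subset by metis
  have FA: "F \<subseteq> carrier A" using F(2) IA by blast
  have "Idl\<^bsub>A\<^esub> F \<subseteq> I" using A.genideal_minimal[OF I F(2)] .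
  moreover have "I \<subseteq> Idl\<^bsub>A\<^esub> F"
    using Idl_invariant_ideal_Int[OF I] mem_Idl_invariant_iff[OF FA] F(3) by blast
  ultimately show "\<exists>F\<subseteq>carrier A. finite F \<and> I = Idl\<^bsub>A\<^esub> F" using FA F(1) by blast
qed

text \<open>An \<open>A\<close>-submodule \<open>N\<close> of \<open>R\<close> is finitely generated modulo the common kernel of the functionals
  \<open>r \<mapsto> trace (y r)\<close>, which is zero when the \<open>y\<close> form the second half of a dual basis.\<close>

lemma finite_generation_mod_traces:
  assumes A: "noetherian_ring A" and ys: "set ys \<subseteq> carrier R"
    and "N \<subseteq> carrier R" "\<zero> \<in> N" "\<And>a b. a \<in> N \<Longrightarrow> b \<in> N \<Longrightarrow> a \<oplus> b \<in> N"
    "\<And>r a. r \<in> carrier A \<Longrightarrow> a \<in> N \<Longrightarrow> r \<otimes> a \<in> N"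
  shows "\<exists>fs. set fs \<subseteq> N \<and>
    (\<forall>r\<in>N. \<exists>s\<in>lincomb R (carrier A) fs. \<forall>y\<in>set ys. trace (y \<otimes> (r \<ominus> s)) = \<zero>)"
  using assms(2-)
proof (induct ys arbitrary: N)
  case Nil
  show ?case by (rule exI[of _ "[]"]) simp
next
  case (Cons y ys)
  interpret A: noetherian_ring A by fact
  note one = A.oneideal
  note N = Cons.prems(2-)
  have y: "y \<in> carrier R" "set ys \<subseteq> carrier R" using Cons.prems(1) by auto
  have image_ideal: "ideal ((\<lambda>r. trace (y \<otimes> r)) ` L) A"
    if "L \<subseteq> carrier R" "\<zero> \<in> L" "\<And>a b. a \<in> L \<Longrightarrow> b \<in> L \<Longrightarrow> a \<oplus> b \<in> L"
    "\<And>r a. r \<in> carrier A \<Longrightarrow> a \<in> L \<Longrightarrow> r \<otimes> a \<in> L" for L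
  proof (rule invariant_ideal_if_closed)
    show "(\<lambda>r. trace (y \<otimes> r)) ` L \<subseteq> carrier A"
      using that(1) y trace_invariant by auto
    show "\<zero> \<in> (\<lambda>r. trace (y \<otimes> r)) ` L"
      by (rule image_eqI[of _ _ \<zero>]) (use that y in simp_all)
  next
    fix a b assume "a \<in> (\<lambda>r. trace (y \<otimes> r)) ` L" "b \<in> (\<lambda>r. trace (y \<otimes> r)) ` L"
    then obtain a' b' where ab: "a' \<in> L" "b' \<in> L" "a = trace (y \<otimes> a')" "b = trace (y \<otimes> b')" by blast
    then have "a' \<in> carrier R" "b' \<in> carrier R" using that(1) by auto
    then show "a \<oplus> b \<in> (\<lambda>r. trace (y \<otimes> r)) ` L"
      using ab y that(3)[OF ab(1,2)]
      by (intro image_eqI[of _ _ "a' \<oplus> b'"]) (simp_all add: r_distr trace_add)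
  next
    fix a r assume "a \<in> (\<lambda>r. trace (y \<otimes> r)) ` L" and r: "r \<in> carrier A"
    then obtain a' where a: "a' \<in> L" "a = trace (y \<otimes> a')" by blast
    then have "a' \<in> carrier R" using that(1) by auto
    then show "r \<otimes> a \<in> (\<lambda>r. trace (y \<otimes> r)) ` L"
      using a y that(4)[OF r a(1)] trace_mult_invariant_mult[OF r _ y(1)]
      by (intro image_eqI[of _ _ "r \<otimes> a'"]) simp_all
  qed
  have image_N: "(\<lambda>r. trace (y \<otimes> r)) ` N \<subseteq> carrier A"
    using ideal.Icarr[OF image_ideal[OF N]] by (rule subsetI)
  \<comment> \<open>The image of \<open>N\<close> under the first functional is a finitely generated
    ideal of the invariants; \<open>es\<close> lifts generators of it to \<open>N\<close>.\<close>
  obtain T where T: "finite T" "T \<subseteq> (\<lambda>r. trace (y \<otimes> r)) ` N"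
    "Idl\<^bsub>A\<^esub> T = Idl\<^bsub>A\<^esub> ((\<lambda>r. trace (y \<otimes> r)) ` N)"
    by (rule A.Idl_finite_subset[OF image_N])
  obtain F where F: "finite F" "F \<subseteq> N" "T = (\<lambda>r. trace (y \<otimes> r)) ` F"
    using finite_subset_image[OF T(1,2)] by blast
  obtain es where es: "set es = F" using finite_list[OF F(1)] by blast
  have esR: "set es \<subseteq> carrier R" using es F(2) N(1) by blast
  have self: "e \<in> lincomb R (carrier A) es" if "e \<in> set es" for e
    using that esR
  proof (induct es)
    case (Cons f fs)
    show ?case
    proof (cases "e = f")
      case True
      then show ?thesis
        using invariant_closed(2) lincomb_zero[OF one, of fs] Cons.prems
        unfolding lincomb.simps(2) by (intro CollectI exI[of _ \<one>] exI[of _ \<zero>]) simp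
    next
      case False
      then have "e \<in> lincomb R (carrier A) fs" "e \<in> carrier R" "f \<in> carrier R"
        using Cons by auto
      then show ?thesis
        unfolding lincomb.simps(2) using invariant_closed(1)
        by (intro CollectI exI[of _ \<zero>] exI[of _ e]) simp
    qed
  qed simp
  have span: "\<exists>s\<in>lincomb R (carrier A) es. trace (y \<otimes> r) = trace (y \<otimes> s)" if "r \<in> N" for r
  proof -
    have "ideal ((\<lambda>r. trace (y \<otimes> r)) ` lincomb R (carrier A) es) A"
      using esR lincomb_carrier[OF one esR] lincomb_zero[OF one esR] lincomb_add[OF one esR]
        lincomb_mult[OF one esR]
      by (intro image_ideal) auto
    then have "Idl\<^bsub>A\<^esub> T \<subseteq> (\<lambda>r. trace (y \<otimes> r)) ` lincomb R (carrier A) es"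
      using self F(3) es by (intro A.genideal_minimal) auto
    moreover have "trace (y \<otimes> r) \<in> Idl\<^bsub>A\<^esub> T"
      unfolding T(3) using A.genideal_self[OF image_N] that by blast
    ultimately show ?thesis by blast
  qed
  \<comment> \<open>Subtracting a combination of \<open>es\<close> moves any element of
    \<open>N\<close> into this kernel, where the induction hypothesis handles the remaining
    functionals.\<close>
  define N' where "N' = {r \<in> N. trace (y \<otimes> r) = \<zero>}"
  have "\<exists>fs. set fs \<subseteq> N' \<and>
    (\<forall>r\<in>N'. \<exists>s\<in>lincomb R (carrier A) fs. \<forall>y\<in>set ys. trace (y \<otimes> (r \<ominus> s)) = \<zero>)"
  proof (rule Cons.hyps[OF y(2)])
    show "N' \<subseteq> carrier R" "\<zero> \<in> N'" using N(1,2) y by (auto simp: N'_def)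
  next
    fix a b assume "a \<in> N'" "b \<in> N'"
    moreover from this have "a \<in> carrier R" "b \<in> carrier R" using N(1) by (auto simp: N'_def)
    ultimately show "a \<oplus> b \<in> N'" using N(3) y by (simp add: N'_def r_distr trace_add)
  next
    fix r a assume r: "r \<in> carrier A" "a \<in> N'"
    moreover from this have "a \<in> carrier R" using N(1) by (auto simp: N'_def)
    ultimately show "r \<otimes> a \<in> N'"
      using N(4) y invariantD(1)[OF r(1)] by (simp add: N'_def trace_mult_invariant_mult)
  qed
  then obtain fs where fs: "set fs \<subseteq> N'" "\<And>r. r \<in> N' \<Longrightarrow>
      \<exists>s\<in>lincomb R (carrier A) fs. \<forall>y\<in>set ys. trace (y \<otimes> (r \<ominus> s)) = \<zero>" by blast
  have fsN: "set fs \<subseteq> N" using fs(1) by (auto simp: N'_def)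
  have fsR: "set fs \<subseteq> carrier R" using fsN N(1) by blast
  show ?case
  proof (intro exI[of _ "es @ fs"] conjI ballI)
    show "set (es @ fs) \<subseteq> N" using es F(2) fsN by auto
    fix r assume r: "r \<in> N"
    then have rR: "r \<in> carrier R" using N(1) by blast
    obtain s where s: "s \<in> lincomb R (carrier A) es" "trace (y \<otimes> r) = trace (y \<otimes> s)"
      using span[OF r] by blast
    have sR: "s \<in> carrier R" using lincomb_carrier[OF one esR s(1)] .
    have sN: "s \<in> N" using lincomb_subset[OF one N(2-4), of es] es F(2) s(1) by blast
    have trace_diff: "trace (y' \<otimes> (a \<ominus> b)) = trace (y' \<otimes> a) \<ominus> trace (y' \<otimes> b)"
      if "y' \<in> carrier R" "a \<in> carrier R" "b \<in> carrier R" for y' a b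
    proof -
      have "trace (y' \<otimes> a) = trace (y' \<otimes> (a \<ominus> b) \<oplus> y' \<otimes> b)"
        using that by (intro arg_cong[of _ _ trace]) algebra
      also have "\<dots> = trace (y' \<otimes> (a \<ominus> b)) \<oplus> trace (y' \<otimes> b)"
        using that by (simp add: trace_add)
      finally have e: "trace (y' \<otimes> a) = trace (y' \<otimes> (a \<ominus> b)) \<oplus> trace (y' \<otimes> b)" .
      have "trace (y' \<otimes> (a \<ominus> b)) \<in> carrier R" "trace (y' \<otimes> b) \<in> carrier R" using that by simp_all
      then show ?thesis unfolding e by algebra
    qed
    have "\<ominus> \<one> \<otimes> s \<in> N" using N(4)[OF _ sN, of "\<ominus> \<one>"] invariant_closed(2,5) by simp
    then have "r \<ominus> s \<in> N" using N(3)[OF r] sR by (simp add: l_minus minus_eq)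
    then have "r \<ominus> s \<in> N'"
      using trace_diff[OF y(1) rR sR] s(2) sR y by (simp add: N'_def r_neg minus_eq)
    then obtain t where t: "t \<in> lincomb R (carrier A) fs"
      "\<And>y'. y' \<in> set ys \<Longrightarrow> trace (y' \<otimes> ((r \<ominus> s) \<ominus> t)) = \<zero>" using fs(2) by blast
    have tR: "t \<in> carrier R" using lincomb_carrier[OF one fsR t(1)] .
    \<comment> \<open>The second correction \<open>t\<close> is spanned by elements of
      \<open>N'\<close>, so it leaves the first functional at zero.\<close>
    have "trace (y \<otimes> t) = \<zero>"
    proof -
      have "t \<in> {r \<in> carrier R. trace (y \<otimes> r) = \<zero>}"
      proof (rule subsetD[OF lincomb_subset[OF one] t(1)])
        fix r a assume "r \<in> carrier A" "a \<in> {r \<in> carrier R. trace (y \<otimes> r) = \<zero>}"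
        then show "r \<otimes> a \<in> {r \<in> carrier R. trace (y \<otimes> r) = \<zero>}"
          using y invariantD(1) by (simp add: trace_mult_invariant_mult)
      qed (use y fs(1) fsR in \<open>auto simp: N'_def r_distr trace_add\<close>)
      then show ?thesis by simp
    qed
    then have "trace (y \<otimes> ((r \<ominus> s) \<ominus> t)) = \<zero>"
      using trace_diff[OF y(1), of "r \<ominus> s" t] trace_diff[OF y(1) rR sR] s(2) rR sR tR y
      by (simp add: r_neg minus_eq)
    moreover have "r \<ominus> (s \<oplus> t) = (r \<ominus> s) \<ominus> t" using rR sR tR by algebra
    moreover have "s \<oplus> t \<in> lincomb R (carrier A) (es @ fs)"
      using lincomb_append[OF one _ s(1) t(1)] esR fsR by simp
    ultimately show "\<exists>s\<in>lincomb R (carrier A) (es @ fs). \<forall>y\<in>set (y # ys). trace (y \<otimes> (r \<ominus> s)) = \<zero>"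
      using t(2) by (intro bexI[of _ "s \<oplus> t"]) auto
  qed
qed

text \<open>An element whose traces against all second components of \<open>dual_pairs\<close>
  vanish is zero, so an ideal of \<open>R\<close> is finitely generated even as a module over the
  invariants.\<close>

lemma noetherian_if_invariant_ring:
  assumes "noetherian_ring A"
  shows "noetherian_ring R"
proof (rule noetherian_ringI)
  fix K assume "ideal K R"
  then interpret K: ideal K R .
  have ys: "set (map snd dual_pairs) \<subseteq> carrier R" using dual_pairs(1) by auto
  obtain fs where fs: "set fs \<subseteq> K"
    "\<And>r. r \<in> K \<Longrightarrow> \<exists>s\<in>lincomb R (carrier A) fs. \<forall>y\<in>set (map snd dual_pairs). trace (y \<otimes> (r \<ominus> s)) = \<zero>"
    using finite_generation_mod_traces[OF assms ys, of K] K.Icarr K.add_mem K.I_l_closed invariantD(1)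
      K.zero_closed by (metis subsetI)
  have fsR: "set fs \<subseteq> carrier R" using fs(1) K.Icarr by blast
  have "r \<in> Idl (set fs)" if r: "r \<in> K" for r
  proof -
    obtain s where s: "s \<in> lincomb R (carrier A) fs"
      "\<forall>y\<in>snd ` set dual_pairs. trace (y \<otimes> (r \<ominus> s)) \<in> {\<zero>}"
      using fs(2)[OF r] by auto
    have s': "s \<in> Idl (set fs)" using s(1) lincomb_subset_Idl[OF fsR] by blast
    interpret I: ideal "Idl (set fs)" R using genideal_ideal[OF fsR] .
    have "r \<ominus> s \<in> {\<zero>}"
      using r K.Icarr s' I.Icarr by (intro mem_if_trace_mem[OF zeroideal _ s(2)]) auto
    then have "r \<ominus> s \<in> Idl (set fs)" using I.zero_closed by simp
    then show ?thesis using I.mem_if_diff_mem s' r K.Icarr by blast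
  qed
  moreover have "Idl (set fs) \<subseteq> K" using genideal_minimal[OF K.is_ideal fs(1)] .
  ultimately show "\<exists>F\<subseteq>carrier R. finite F \<and> K = Idl F" using fsR by blast
qed

section \<open>Lying over, maximal ideals and heights\<close>

lemma lying_over_below:
  assumes P: "primeideal P R" and q: "primeideal q A" "q \<subseteq> P"
  obtains Q where "primeideal Q R" "Q \<subseteq> P" "Q \<inter> carrier A = q"
proof -
  interpret q: primeideal q A by fact
  have qA: "q \<subseteq> carrier A" using q.Icarr by blast
  then have qR: "q \<subseteq> carrier R" using invariantD(1) by blast
  \<comment> \<open>The extension of \<open>q\<close> meets the invariants only in \<open>q\<close>,
    so a prime above it that avoids the complement of \<open>q\<close> contracts to
    \<open>q\<close>.\<close>
  have "Idl q \<inter> (carrier A - q) = {}" using Idl_invariant_ideal_Int[OF q.is_ideal] by blast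
  moreover have "\<one> \<in> carrier A - q"
    using q.one_imp_carrier q.I_notcarr invariant_closed(2) by auto
  moreover have "s \<otimes> t \<in> carrier A - q" if "s \<in> carrier A - q" "t \<in> carrier A - q" for s t
    using that q.I_prime[of s t] invariant_closed(4) by auto
  ultimately obtain Q where Q: "primeideal Q R" "Idl q \<subseteq> Q" "Q \<inter> (carrier A - q) = {}"
    using exists_primeideal_disjoint[OF genideal_ideal[OF qR], of "carrier A - q"] invariantD(1)
    by (metis DiffD1 subsetI)
  have Qq: "Q \<inter> carrier A = q" using Q genideal_self[OF qR] qA by blast
  \<comment> \<open>The prime found need not lie below \<open>P\<close>, but its contraction does;
    hence a translate lies below \<open>P\<close>, and translates have the same contraction.\<close>
  have "Q \<inter> carrier A \<subseteq> P" using Qq q(2) by blast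
  then obtain g where g: "g \<in> carrier G" "\<And>r. r \<in> Q \<Longrightarrow> \<phi> g r \<in> P"
    using translate_if_contraction_subset[OF primeideal.axioms(1)[OF Q(1)] P] by metis
  interpret G: group G by (rule group_G)
  define Q' where "Q' = {r \<in> carrier R. \<phi> (inv\<^bsub>G\<^esub> g) r \<in> Q}"
  have "primeideal Q' R" unfolding Q'_def using translate_primeideal[OF _ Q(1)] g(1) by simp
  moreover have "r \<in> P" if "r \<in> Q'" for r
    using that g(1) g(2)[of "\<phi> (inv\<^bsub>G\<^esub> g) r"] by (auto simp: Q'_def)
  moreover have "Q' \<inter> carrier A = Q \<inter> carrier A"
    using g(1) invariantD by (auto simp: Q'_def)
  ultimately show thesis using that Qq by (metis subsetI)
qed

text \<open>A proper ideal \<open>J\<close> above the contraction extends to a proper ideal, which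
  lies in some maximal \<open>N\<close>. A translate \<open>L\<close> of \<open>N\<close> contains
  \<open>M\<close>, so \<open>L = M\<close>; and \<open>L\<close> contains \<open>J\<close>, whose
  elements are fixed by the group.\<close>

lemma contraction_maximalideal:
  assumes "maximalideal M R"
  shows "maximalideal (M \<inter> carrier A) A"
proof (rule maximalidealI)
  interpret M: maximalideal M R by fact
  show "ideal (M \<inter> carrier A) A" using contraction_ideal[OF M.is_ideal] .
  show "carrier A \<noteq> M \<inter> carrier A"
    using M.one_imp_carrier M.I_notcarr invariant_closed(2) by auto
  fix J assume J: "ideal J A" "M \<inter> carrier A \<subseteq> J" "J \<subseteq> carrier A"
  have JR: "J \<subseteq> carrier R" using J(3) invariantD(1) by blast
  show "J = M \<inter> carrier A \<or> J = carrier A"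
  proof (cases "\<one> \<in> J")
    case True
    then show ?thesis using ideal.one_imp_carrier[OF J(1)] by simp
  next
    case False
    then have "Idl J \<noteq> carrier R" using Idl_invariant_ideal_Int[OF J(1)] invariant_closed(2) by auto
    then obtain N where N: "maximalideal N R" "Idl J \<subseteq> N"
      using exists_maximalideal[OF genideal_ideal[OF JR]] by metis
    interpret N: maximalideal N R by fact
    have "M \<inter> carrier A \<subseteq> N" using J(2) N(2) genideal_self[OF JR] by blast
    then obtain g where g: "g \<in> carrier G" "\<And>r. r \<in> M \<Longrightarrow> \<phi> g r \<in> N"
      using translate_if_contraction_subset[OF M.is_ideal maximalideal_prime[OF N(1)]] by metis
    define L where "L = {r \<in> carrier R. \<phi> g r \<in> N}"
    have "ideal L R" unfolding L_def using translate_ideal[OF g(1) N.is_ideal] .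
    moreover have "M \<subseteq> L" unfolding L_def using g M.Icarr by blast
    moreover have "\<one> \<notin> L" using g(1) N.one_imp_carrier N.I_notcarr by (auto simp: L_def)
    ultimately have "L = M" using M.I_maximal[of L] L_def by blast
    moreover have "J \<subseteq> L"
    proof
      fix a assume "a \<in> J"
      then have "a \<in> carrier A" "a \<in> N" using J(3) N(2) genideal_self[OF JR] by auto
      then show "a \<in> L" using g(1) unfolding L_def by (simp add: invariantD)
    qed
    ultimately show ?thesis using J(2,3) by blast
  qed
qed

lemma exists_maximalideal_over:
  assumes "maximalideal m A"
  obtains M where "maximalideal M R" "M \<inter> carrier A = m"
proof -
  interpret m: maximalideal m A by fact
  have mR: "m \<subseteq> carrier R" using m.Icarr invariantD(1) by blast
  have "\<one> \<notin> m" using m.one_imp_carrier m.I_notcarr by auto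
  then have "Idl m \<noteq> carrier R" using Idl_invariant_ideal_Int[OF m.is_ideal] invariant_closed(2) by auto
  then obtain M where M: "maximalideal M R" "Idl m \<subseteq> M"
    using exists_maximalideal[OF genideal_ideal[OF mR]] by metis
  interpret c: maximalideal "M \<inter> carrier A" A using contraction_maximalideal[OF M(1)] .
  have "m \<subseteq> M \<inter> carrier A" using M(2) genideal_self[OF mR] m.Icarr by blast
  then have "M \<inter> carrier A = m"
    using m.I_maximal[OF c.is_ideal] c.I_notcarr by blast
  with M(1) show thesis using that by blast
qed

text \<open>Chains contract to strict chains by \<open>primeideal_incomparable\<close>. Conversely,
  a chain below the contraction is lifted from the top downwards by \<open>lying_over_below\<close>,
  and for this the top prime has to vary in the induction.\<close>

lemma prime_height_contraction:
  assumes P: "primeideal P R"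
  shows "prime_height A (P \<inter> carrier A) = prime_height R P"
proof -
  have down: "\<exists>q. (\<forall>i\<le>n. primeideal (q i) A) \<and> (\<forall>i<n. q i \<subset> q (Suc i)) \<and> q n = P \<inter> carrier A"
    if Q: "\<forall>i\<le>n. primeideal (Q i) R" "\<forall>i<n. Q i \<subset> Q (Suc i)" "Q n = P" for n and Q :: "nat \<Rightarrow> _"
  proof (intro exI[of _ "\<lambda>i. Q i \<inter> carrier A"] conjI allI impI)
    fix i assume "i < n"
    then have "primeideal (Q i) R" "primeideal (Q (Suc i)) R" "Q i \<subset> Q (Suc i)" using Q by auto
    then show "Q i \<inter> carrier A \<subset> Q (Suc i) \<inter> carrier A"
      using primeideal_incomparable[of "Q i" "Q (Suc i)"] by blast
  qed (use Q contraction_primeideal in auto)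
  have up: "\<exists>Q. (\<forall>i\<le>n. primeideal (Q i) R) \<and> (\<forall>i<n. Q i \<subset> Q (Suc i)) \<and> Q n = P"
    if "\<forall>i\<le>n. primeideal (q i) A" "\<forall>i<n. q i \<subset> q (Suc i)" "q n = P \<inter> carrier A" "primeideal P R"
    for n and q :: "nat \<Rightarrow> _" and P
    using that
  proof (induct n arbitrary: P)
    case 0
    then show ?case by auto
  next
    case (Suc n)
    have "primeideal (q n) A" "q n \<subseteq> P" using Suc.prems(1-3) by auto
    then obtain P' where P': "primeideal P' R" "P' \<subseteq> P" "P' \<inter> carrier A = q n"
      using lying_over_below[OF Suc.prems(4)] by metis
    have "\<exists>Q. (\<forall>i\<le>n. primeideal (Q i) R) \<and> (\<forall>i<n. Q i \<subset> Q (Suc i)) \<and> Q n = P'"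
      using Suc.prems P' by (intro Suc.hyps) auto
    then obtain Q where Q: "\<forall>i\<le>n. primeideal (Q i) R" "\<forall>i<n. Q i \<subset> Q (Suc i)" "Q n = P'" by blast
    have "P' \<noteq> P" using Suc.prems(2,3) P'(3) by auto
    then have "P' \<subset> P" using P'(2) by blast
    then show ?case
      using Q Suc.prems(4) by (intro exI[of _ "Q(Suc n := P)"]) (auto simp: le_Suc_eq less_Suc_eq)
  qed
  have "{n. \<exists>Q. (\<forall>i\<le>n. primeideal (Q i) A) \<and> (\<forall>i<n. Q i \<subset> Q (Suc i)) \<and> Q n = P \<inter> carrier A}
      = {n. \<exists>Q. (\<forall>i\<le>n. primeideal (Q i) R) \<and> (\<forall>i<n. Q i \<subset> Q (Suc i)) \<and> Q n = P}"
    by (intro Collect_cong iffI; elim exE conjE) (rule up[OF _ _ _ P] down; assumption)+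
  then show ?thesis unfolding prime_height_def by simp
qed

section \<open>Depth and the Cohen-Macaulay property\<close>

lemma invariant_regular_sequence:
  assumes N: "noetherian_ring R" and M: "ideal M R" and ys: "regular_over R {} ys" "set ys \<subseteq> M"
  shows "\<exists>xs. regular_over R {} xs \<and> set xs \<subseteq> M \<inter> carrier A \<and> length xs = length ys"
proof -
  interpret R: noetherian_cring R using N is_cring by (intro noetherian_cring.intro)
  interpret M: ideal M R by fact
  have "\<exists>xs. regular_over R {} xs \<and> set xs \<subseteq> M \<inter> carrier A \<and> length xs = k" if "k \<le> length ys" for k
    using that
  proof (induct k)
    case 0
    show ?case by (rule exI[of _ "[]"]) simp
  next
    case (Suc k)
    then obtain xs where xs: "regular_over R {} xs" "set xs \<subseteq> M \<inter> carrier A" "length xs = k" by auto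
    \<comment> \<open>As long as \<open>xs\<close> is shorter than \<open>ys\<close>, Rees' theorem
      extends it by some \<open>z\<close> in \<open>M\<close>. The norm of \<open>z\<close> is an
      equally good extension and is invariant.\<close>
    obtain z where z: "z \<in> M" "nonzerodivisor_mod R (Idl (set xs)) z"
      using R.regular_sequence_extend[OF M xs(1) _ ys] xs(2,3) Suc.prems by auto
    have zR: "z \<in> carrier R" using z(1) M.Icarr by blast
    have "regular_over R {} (xs @ [norm z])"
      using xs nonzerodivisor_mod_norm[OF _ zR z(2)] by (simp add: regular_over_append)
    then show ?case
      using xs norm_mem[OF M z(1)] norm_invariant[OF zR] by (intro exI[of _ "xs @ [norm z]"]) auto
  qed
  then show ?thesis by blast
qed

text \<open>The sets of regular sequences differ, but their sets of lengths agree: a sequence in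
  \<open>M\<close> is replaced by an invariant one of the same length. Inside a proper ideal the
  generated ideals are proper on both sides.\<close>

lemma ideal_depth_contraction:
  assumes N: "noetherian_ring R" and M: "ideal M R" "M \<noteq> carrier R"
  shows "ideal_depth A (M \<inter> carrier A) = ideal_depth R M"
proof -
  interpret A: cring A by (rule invariant_ring_cring)
  interpret M: ideal M R by fact
  have "\<one> \<notin> M" using M.one_imp_carrier M(2) by auto
  then have properR: "Idl (set xs) \<noteq> carrier R" if "set xs \<subseteq> M" for xs
    using genideal_minimal[OF M(1) that] by blast
  have properA: "Idl\<^bsub>A\<^esub> (set xs) \<noteq> carrier A" if "set xs \<subseteq> M \<inter> carrier A" for xs
    using A.genideal_minimal[OF contraction_ideal[OF M(1)] that] \<open>\<one> \<notin> M\<close> invariant_closed(2) by blast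
  have "length ` {xs. regular_sequence A xs \<and> set xs \<subseteq> M \<inter> carrier A}
      = length ` {xs. regular_sequence R xs \<and> set xs \<subseteq> M}"
  proof (intro equalityI subsetI)
    fix n assume "n \<in> length ` {xs. regular_sequence A xs \<and> set xs \<subseteq> M \<inter> carrier A}"
    then obtain xs where xs: "regular_sequence A xs" "set xs \<subseteq> M \<inter> carrier A" "n = length xs" by blast
    then have "regular_sequence R xs"
      using regular_over_iff[of "{}" xs] properR[of xs] M.Icarr
      by (auto simp: regular_sequence_iff_regular_over)
    then show "n \<in> length ` {xs. regular_sequence R xs \<and> set xs \<subseteq> M}" using xs by auto
  next
    fix n assume "n \<in> length ` {xs. regular_sequence R xs \<and> set xs \<subseteq> M}"
    then obtain ys where ys: "regular_over R {} ys" "set ys \<subseteq> M" "n = length ys"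
      by (auto simp: regular_sequence_iff_regular_over)
    then obtain xs where xs: "regular_over R {} xs" "set xs \<subseteq> M \<inter> carrier A" "length xs = n"
      using invariant_regular_sequence[OF N M(1) ys(1,2)] by auto
    then have "regular_sequence A xs"
      using regular_over_iff[of "{}" xs] properA[of xs]
      by (auto simp: regular_sequence_iff_regular_over)
    then show "n \<in> length ` {xs. regular_sequence A xs \<and> set xs \<subseteq> M \<inter> carrier A}" using xs by auto
  qed
  then have "enat ` length ` {xs. regular_sequence A xs \<and> set xs \<subseteq> M \<inter> carrier A}
      = enat ` length ` {xs. regular_sequence R xs \<and> set xs \<subseteq> M}" by simp
  then show ?thesis unfolding ideal_depth_def image_image by simp
qed

text \<open>Every maximal ideal of the invariants is the contraction of one of \<open>R\<close>,
  with the same depth and height. The comparison of depths supposes \<open>R\<close> noetherian,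
  which either side of the equivalence provides.\<close>

lemma cohen_macaulay_invariant_ring_iff: "cohen_macaulay A \<longleftrightarrow> cohen_macaulay R"
proof -
  have "(\<forall>m. maximalideal m A \<longrightarrow> ideal_depth A m = prime_height A m) \<longleftrightarrow>
      (\<forall>M. maximalideal M R \<longrightarrow> ideal_depth R M = prime_height R M)" if N: "noetherian_ring R"
  proof -
    have eq: "ideal_depth A (M \<inter> carrier A) = ideal_depth R M"
      "prime_height A (M \<inter> carrier A) = prime_height R M" if "maximalideal M R" for M
    proof -
      interpret M: maximalideal M R by fact
      show "ideal_depth A (M \<inter> carrier A) = ideal_depth R M"
        using ideal_depth_contraction[OF N M.is_ideal] M.I_notcarr by simp
      show "prime_height A (M \<inter> carrier A) = prime_height R M"
        using prime_height_contraction[OF maximalideal_prime[OF that]] .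
    qed
    show ?thesis
      using eq contraction_maximalideal exists_maximalideal_over by metis
  qed
  then show ?thesis
    unfolding cohen_macaulay_def
    using noetherian_invariant_ring noetherian_if_invariant_ring invariant_ring_cring is_cring by blast
qed

end

theorem proposition3p2:
  fixes G :: "('g, 'm) monoid_scheme" and R :: "('r, 'n) ring_scheme"
    and \<phi> :: "'g \<Rightarrow> 'r \<Rightarrow> 'r"
  assumes "ring_action G R \<phi>"
    and "finite (carrier G)"
    and "galois_action G R \<phi>"
  shows "cohen_macaulay (invariant_ring G R \<phi>) \<longleftrightarrow> cohen_macaulay R"
proof -
  interpret ring_action G R \<phi> by fact
  interpret galois_ring_action G R \<phi>
    by unfold_locales (use assms in auto)
  show ?thesis by (rule cohen_macaulay_invariant_ring_iff)
qed

end
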